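(* Let $J,R,Q\in\mathbb{R}^{n\times n}$, $B,P\in\mathbb{R}^{n\times m}$, $D\in\mathbb{R}^{m\times m}$ satisfy $J=-J^\top$, $R=R^\top\ge0$, $Q=Q^\top\ge0$, $S:=\tfrac12(D+D^\top)\ge 0$ and $$W:=\begin{pmatrix}QRQ&QP\\P^\top Q&S\end{pmatrix}\ge0,\qquad W\neq0.$$ Let $\mathbb{U}\subset\mathbb{R}^m$ be convex and compact with $0\in\operatorname{int}\mathbb{U}$ and let $\Phi\subset\mathbb{R}^n$ be closed. For $T>0$ and $x^0\in\mathbb{R}^n$ consider $$ \min_{u\in L^1(0,T;\mathbb{U})}\int_0^Tu(t)^\top y(t)\,dt\quad\text{s.t. }\dot x=(J-R)Qx+(B-P)u,\quad y=(B+P)^\top Qx+Du,\quad x(0)=x^0,\quad x(T)\in\Phi.\qquad(\mathrm{OCP}_{T,x^0}) $$ Let $(\bar x,\bar u)\in\mathbb{R}^n\times\operatorname{int}\mathbb{U}$ be an optimal steady state such that $\bar x\in\mathcal{C}(\Phi)$. Then the problem has the integral input-state subspace turnpike property on $\mathcal{C}(\bar x)$ with respect to $\ker W$: there exist continuous functions $F,\tau:\mathcal{C}(\bar x)\to[0,\infty)$ such that for all $x^0\in\mathcal{C}(\bar x)$, all $T>\tau(x^0)$ and each optimal pair $(x^\star,u^\star)$ of $(\mathrm{OCP}_{T,x^0})$, $$\int_0^T\operatorname{dist}^2\big((x^\star(t),u^\star(t)),\ker W\big)\,dt\le F(x^0).$$ If, additionally, $((J-R)Q,B-P)$ is controllable,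 then the turnpike property is global in the initial state, i.e., $\mathcal{C}(\bar x)=\mathbb{R}^n$.
   Context: $L^1(0,T;\mathbb{U})$ denotes the integrable functions on $[0,T]$ with values in $\mathbb{U}$; $\operatorname{dist}$ is the Euclidean distance. Reachability (under $\dot x=(J-R)Qx+(B-P)u$): $z$ is reachable from $x$ at time $t>0$ if some $u\in L^1(0,t;\mathbb{U})$ yields a solution starting at $x$ with value $z$ at time $t$. $\mathcal{C}_t(z)$ is the set of states from which $z$ is reachable at time $t$, $\mathcal{C}_0(z)=\{z\}$, $\mathcal{C}(z)=\bigcup_{t\ge0}\mathcal{C}_t(z)$, $\mathcal{C}(\Phi)=\bigcup_{z\in\Phi}\mathcal{C}(z)$. A steady state is a pair $(\bar x,\bar u)\in\mathbb{R}^n\times\mathbb{U}$ with $(J-R)Q\bar x+(B-P)\bar u=0$. It is optimal if it minimizes $\bar u^\top\bar y$, where $\bar y=(B+P)^\top Q\bar x+D\bar u$, among all steady states in $\mathbb{R}^n\times\mathbb{U}$. $(A,\tilde B)$ is controllable if $\operatorname{rank}(\tilde B,A\tilde B,\dots,A^{n-1}\tilde B)=n$. An optimal pair consists of an optimal control and the corresponding state. *)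

theory Defs
  imports "HOL-Analysis.Analysis"
begin

section \<open>Matrices\<close>

definition psd :: "real^'k^'k \<Rightarrow> bool" where
  "psd M \<longleftrightarrow> transpose M = M \<and> (\<forall>v. 0 \<le> v \<bullet> (M *v v))"

definition block_matrix ::
  "real^'n^'n \<Rightarrow> real^'m^'n \<Rightarrow> real^'n^'m \<Rightarrow> real^'m^'m \<Rightarrow> real^('n + 'm)^('n + 'm)" where
  "block_matrix M11 M12 M21 M22 =
     (\<chi> i j. case i of
        Inl a \<Rightarrow> (case j of Inl b \<Rightarrow> M11 $ a $ b | Inr b \<Rightarrow> M12 $ a $ b)
      | Inr a \<Rightarrow> (case j of Inl b \<Rightarrow> M21 $ a $ b | Inr b \<Rightarrow> M22 $ a $ b))"

definition stack :: "real^'n \<Rightarrow> real^'m \<Rightarrow> real^('n + 'm)" where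
  "stack x u = (\<chi> i. case i of Inl a \<Rightarrow> x $ a | Inr b \<Rightarrow> u $ b)"

definition ker :: "real^'k^'l \<Rightarrow> (real^'k) set" where
  "ker M = {v. M *v v = 0}"

text \<open>
  The matrix \<open>(B, A B, \<dots>, A^(n-1) B)\<close>. Its columns are indexed by \<open>'n \<times> 'm\<close>, and
  \<open>to_nat_on UNIV\<close> is a bijection from the finite type \<open>'n\<close> onto \<open>{..<CARD('n)}\<close>, so each
  exponent \<open>0, \<dots>, n - 1\<close> occurs for exactly one block. The iteration \<open>((**) A ^^ k) B\<close> is
  \<open>A^k B\<close>; the operator \<open>^\<close> on \<open>real^'n^'n\<close> would be the componentwise power.
\<close>
definition kalman_matrix :: "real^'n^'n \<Rightarrow> real^'m^'n \<Rightarrow> real^('n \<times> 'm)^'n" where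
  "kalman_matrix A B =
     (\<chi> i p. (((**) A ^^ to_nat_on (UNIV :: 'n set) (fst p)) B) $ i $ snd p)"

definition controllable :: "real^'n^'n \<Rightarrow> real^'m^'n \<Rightarrow> bool" where
  "controllable A B \<longleftrightarrow> rank (kalman_matrix A B) = CARD('n)"

section \<open>Controlled linear systems \<open>x' = A x + B u\<close>, \<open>y = C x + D u\<close>\<close>

text \<open>
  \<open>L1_controls T U\<close> is \<open>L\<^sup>1(0,T;U)\<close>. Functions are representatives of their classes, hence
  the constraint holds almost everywhere; values outside \<open>[0,T]\<close> are irrelevant.
\<close>
definition L1_controls :: "real \<Rightarrow> (real^'m) set \<Rightarrow> (real \<Rightarrow> real^'m) set" where
  "L1_controls T U =
     {u. u absolutely_integrable_on {0..T} \<and> (AE t in lebesgue. t \<in> {0..T} \<longrightarrow> u t \<in> U)}"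

text \<open>
  Caratheodory solutions on \<open>[0,T]\<close>: \<open>x\<close> lies in \<open>W\<^sup>1\<^sup>,\<^sup>1\<close> with weak derivative \<open>A x + B u\<close>,
  i.e. \<open>x\<close> is the indefinite integral of this \<open>L\<^sup>1\<close> function.
\<close>
definition is_solution ::
  "real^'n^'n \<Rightarrow> real^'m^'n \<Rightarrow> real \<Rightarrow> (real \<Rightarrow> real^'m) \<Rightarrow> (real \<Rightarrow> real^'n) \<Rightarrow> bool" where
  "is_solution A B T u x \<longleftrightarrow>
     (\<lambda>s. A *v x s + B *v u s) absolutely_integrable_on {0..T} \<and>
     (\<forall>t\<in>{0..T}. x t = x 0 + integral {0..t} (\<lambda>s. A *v x s + B *v u s))"

text \<open>
  The sets \<open>C_t(z)\<close>, \<open>C(z)\<close>, \<open>C(\<Phi>)\<close> are backward reachable: they collect the initial states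
  \<^emph>\<open>from\<close> which the target can be reached.
\<close>
definition reach_at ::
  "real^'n^'n \<Rightarrow> real^'m^'n \<Rightarrow> (real^'m) set \<Rightarrow> real \<Rightarrow> real^'n \<Rightarrow> (real^'n) set" where
  "reach_at A B U t z =
     (if t = 0 then {z}
      else {x0. \<exists>u\<in>L1_controls t U. \<exists>x. is_solution A B t u x \<and> x 0 = x0 \<and> x t = z})"

definition reach_point ::
  "real^'n^'n \<Rightarrow> real^'m^'n \<Rightarrow> (real^'m) set \<Rightarrow> real^'n \<Rightarrow> (real^'n) set" where
  "reach_point A B U z = (\<Union>t\<in>{0..}. reach_at A B U t z)"

definition reach_set ::
  "real^'n^'n \<Rightarrow> real^'m^'n \<Rightarrow> (real^'m) set \<Rightarrow> (real^'n) set \<Rightarrow> (real^'n) set" where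
  "reach_set A B U \<Phi> = (\<Union>z\<in>\<Phi>. reach_point A B U z)"

definition supply_rate :: "real^'n^'m \<Rightarrow> real^'m^'m \<Rightarrow> real^'n \<Rightarrow> real^'m \<Rightarrow> real" where
  "supply_rate C D x u = u \<bullet> (C *v x + D *v u)"

definition steady_state ::
  "real^'n^'n \<Rightarrow> real^'m^'n \<Rightarrow> (real^'m) set \<Rightarrow> real^'n \<Rightarrow> real^'m \<Rightarrow> bool" where
  "steady_state A B U x u \<longleftrightarrow> u \<in> U \<and> A *v x + B *v u = 0"

definition optimal_steady_state ::
  "real^'n^'n \<Rightarrow> real^'m^'n \<Rightarrow> real^'n^'m \<Rightarrow> real^'m^'m \<Rightarrow> (real^'m) set \<Rightarrow>
   real^'n \<Rightarrow> real^'m \<Rightarrow> bool" where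
  "optimal_steady_state A B C D U x u \<longleftrightarrow>
     steady_state A B U x u \<and>
     (\<forall>x' u'. steady_state A B U x' u' \<longrightarrow> supply_rate C D x u \<le> supply_rate C D x' u')"

section \<open>The optimal control problem and the turnpike property\<close>

definition admissible_pair ::
  "real^'n^'n \<Rightarrow> real^'m^'n \<Rightarrow> (real^'m) set \<Rightarrow> (real^'n) set \<Rightarrow> real \<Rightarrow> real^'n \<Rightarrow>
   (real \<Rightarrow> real^'n) \<Rightarrow> (real \<Rightarrow> real^'m) \<Rightarrow> bool" where
  "admissible_pair A B U \<Phi> T x0 x u \<longleftrightarrow>
     u \<in> L1_controls T U \<and> is_solution A B T u x \<and> x 0 = x0 \<and> x T \<in> \<Phi>"

text \<open>
  For an admissible pair and bounded \<open>U\<close> the integrand is bounded and measurable, so the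
  cost is a genuine integral.
\<close>
definition cost ::
  "real^'n^'m \<Rightarrow> real^'m^'m \<Rightarrow> real \<Rightarrow> (real \<Rightarrow> real^'n) \<Rightarrow> (real \<Rightarrow> real^'m) \<Rightarrow> real" where
  "cost C D T x u = integral {0..T} (\<lambda>t. supply_rate C D (x t) (u t))"

definition optimal_pair ::
  "real^'n^'n \<Rightarrow> real^'m^'n \<Rightarrow> real^'n^'m \<Rightarrow> real^'m^'m \<Rightarrow> (real^'m) set \<Rightarrow> (real^'n) set \<Rightarrow>
   real \<Rightarrow> real^'n \<Rightarrow> (real \<Rightarrow> real^'n) \<Rightarrow> (real \<Rightarrow> real^'m) \<Rightarrow> bool" where
  "optimal_pair A B C D U \<Phi> T x0 x u \<longleftrightarrow>
     admissible_pair A B U \<Phi> T x0 x u \<and>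
     (\<forall>x' u'. admissible_pair A B U \<Phi> T x0 x' u' \<longrightarrow> cost C D T x u \<le> cost C D T x' u')"

text \<open>
  Integrability is demanded explicitly because \<open>integral\<close> of a non-integrable function is \<open>0\<close>.
\<close>
definition integral_turnpike ::
  "real^'n^'n \<Rightarrow> real^'m^'n \<Rightarrow> real^'n^'m \<Rightarrow> real^'m^'m \<Rightarrow> (real^'m) set \<Rightarrow> (real^'n) set \<Rightarrow>
   (real^'n) set \<Rightarrow> (real^('n + 'm)) set \<Rightarrow> bool" where
  "integral_turnpike A B C D U \<Phi> X V \<longleftrightarrow>
     (\<exists>F \<tau>. continuous_on X F \<and> continuous_on X \<tau> \<and>
        (\<forall>x0\<in>X. 0 \<le> F x0 \<and> 0 \<le> \<tau> x0) \<and>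
        (\<forall>x0\<in>X. \<forall>T>\<tau> x0. \<forall>x u. optimal_pair A B C D U \<Phi> T x0 x u \<longrightarrow>
           (\<lambda>t. (infdist (stack (x t) (u t)) V)\<^sup>2) integrable_on {0..T} \<and>
           integral {0..T} (\<lambda>t. (infdist (stack (x t) (u t)) V)\<^sup>2) \<le> F x0))"

end

theory Submission
  imports Defs
begin

text \<open>
  Along solutions, \<open>u \<bullet> y\<close> is the derivative of the storage \<open>x \<bullet> Q x / 2\<close> plus the dissipation
  \<open>w \<bullet> W w\<close> with \<open>w = (x, u)\<close>. Comparison with the steady state \<open>(0, 0)\<close> shows that an optimal
  steady state has zero dissipation, so going to \<open>x\<^sub>b\<close>, resting there and leaving for \<open>\<Phi>\<close> is
  a competitor whose cost does not depend on \<open>T\<close>; as \<open>w \<bullet> W w\<close> controls the squared distance of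
  \<open>w\<close> to the kernel of \<open>W\<close>, this bounds the integral. Continuity of the bound in the initial state
  rests on the time to reach \<open>x\<^sub>b\<close> being locally bounded: the states steerable to \<open>x\<^sub>b\<close> in a
  suitable fixed time contain a relative neighbourhood of \<open>x\<^sub>b\<close> in the span of all of them, and
  this span is invariant under the uncontrolled flow.
\<close>

section \<open>The flow of a linear system\<close>

text \<open>Everything is done for the target 0 and the controls U - ub: as \<open>ub\<close> is
  interior to \<open>U\<close>, the origin is interior to the shifted control set. Without
  controllability the states steerable to 0 may lie in a proper subspace, so no full ball is
  available and the span takes the place of the whole space. Near an arbitrary steerable state, the
  nominal control is kept while the deviation drifts freely; the deviation is removed afterwards and
  must still be in the span by then, hence the interest in invariance under the flow. No minimal
  time is studied: a locally bounded transfer time has a continuous majorant, and that is enough.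

  The global claim meets another obstacle. Controls are bounded, so controllability yields merely a
  ball of steerable states, and free motion need not lead into it: \<open>Q\<close> may be singular,
  the storage is then no norm, and motions may grow. With R = 0, Q = diag(0, 1) and J the rotation
  by a right angle, the free system is a double integrator up to sign. A separating hyperplane and
  the adjoint system settle this without any normal form of (J - R) Q.\<close>

definition flow :: "real^'n^'n \<Rightarrow> real \<Rightarrow> real^'n \<Rightarrow> real^'n" where
  "flow A t z = (\<chi> i. \<Sum>k. (((*v) A ^^ k) z $ i / fact k) * t ^ k)"

lemma norm_matrix_vector_mult_le: "norm (A *v x) \<le> onorm ((*v) A) * norm x"
  for A :: "real^'n^'m"
  by (simp add: onorm)

lemma norm_funpow_matrix_le: "norm (((*v) A ^^ k) z) \<le> onorm ((*v) A) ^ k * norm z"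
  for A :: "real^'n^'n"
proof (induction k)
  case (Suc k)
  have "norm (((*v) A ^^ Suc k) z) \<le> onorm ((*v) A) * norm (((*v) A ^^ k) z)"
    by (simp add: norm_matrix_vector_mult_le)
  also have "\<dots> \<le> onorm ((*v) A) * (onorm ((*v) A) ^ k * norm z)"
    using Suc by (intro mult_left_mono) (auto simp: onorm_pos_le)
  finally show ?case by (simp add: mult_ac)
qed simp

text \<open>The series is dominated by that of norm z times exp(K |t|), where K is the operator norm
  of \<open>A\<close>.\<close>

lemma summable_flow: "summable (\<lambda>k. (((*v) A ^^ k) z $ i / fact k) * t ^ k)"
  for A :: "real^'n^'n"
proof (rule summable_comparison_test')
  let ?K = "onorm ((*v) A)"
  show "summable (\<lambda>k. norm z * (inverse (fact k) * (?K * \<bar>t\<bar>) ^ k))"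
    by (intro summable_mult summable_exp)
  fix k :: nat
  have "norm (((*v) A ^^ k) z $ i) \<le> ?K ^ k * norm z"
    using component_le_norm_cart[of "((*v) A ^^ k) z" i] norm_funpow_matrix_le[where A=A and k=k and z=z] by simp
  then have "\<bar>((*v) A ^^ k) z $ i\<bar> * (\<bar>t\<bar> ^ k * inverse (fact k))
      \<le> ?K ^ k * norm z * (\<bar>t\<bar> ^ k * inverse (fact k))"
    by (intro mult_right_mono) auto
  then show "norm ((((*v) A ^^ k) z $ i / fact k) * t ^ k)
      \<le> norm z * (inverse (fact k) * (?K * \<bar>t\<bar>) ^ k)"
    by (simp add: abs_mult power_abs field_simps)
qed

lemma flow_sums: "(\<lambda>k. (((*v) A ^^ k) z $ i / fact k) * t ^ k) sums (flow A t z $ i)"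
  for A :: "real^'n^'n"
  unfolding flow_def vec_lambda_beta by (rule summable_sums[OF summable_flow])

lemma linear_funpow_matrix: "linear ((*v) A ^^ k)" for A :: "real^'n^'n"
  proof (induction k)
  case (Suc k)
  show ?case
    using linear_compose[OF Suc matrix_vector_mul_linear[of A]] by (simp add: o_def)
qed (simp add: id_def linear_id[unfolded id_def])

lemma linear_flow: "linear (flow A t)" for A :: "real^'n^'n"
proof (rule linearI)
  fix x y show "flow A t (x + y) = flow A t x + flow A t y"
  proof (rule vec_eq_iff[THEN iffD2], rule allI)
    fix i
    show "flow A t (x + y) $ i = (flow A t x + flow A t y) $ i"
      using sums_add[OF flow_sums[of A x i t] flow_sums[of A y i t]] flow_sums[of A "x + y" i t]
      by (simp add: linear_add[OF linear_funpow_matrix] add_divide_distrib algebra_simps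
          sums_unique2)
  qed
next
  fix c x show "flow A t (c *\<^sub>R x) = c *\<^sub>R flow A t x"
  proof (rule vec_eq_iff[THEN iffD2], rule allI)
    fix i
    show "flow A t (c *\<^sub>R x) $ i = (c *\<^sub>R flow A t x) $ i"
      using sums_mult[OF flow_sums[of A x i t], of c] flow_sums[of A "c *\<^sub>R x" i t]
      by (simp add: linear_scale[OF linear_funpow_matrix] mult_ac sums_unique2)
  qed
qed

lemma flow_0 [simp]: "flow A 0 z = z" for A :: "real^'n^'n"
proof (rule vec_eq_iff[THEN iffD2], rule allI)
  fix i
  have "flow A 0 z $ i = (\<Sum>k. (((*v) A ^^ k) z $ i / fact k) * 0 ^ k)"
    by (simp add: flow_def)
  also have "\<dots> = z $ i"
    by (subst powser_zero) simp
  finally show "flow A 0 z $ i = z $ i" .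
qed

lemma flow_commute: "A *v flow A t z = flow A t (A *v z)" for A :: "real^'n^'n"
proof (rule vec_eq_iff[THEN iffD2], rule allI)
  fix i
  have "(\<lambda>k. \<Sum>j\<in>UNIV. A $ i $ j * ((((*v) A ^^ k) z $ j / fact k) * t ^ k))
      sums (\<Sum>j\<in>UNIV. A $ i $ j * flow A t z $ j)"
    by (intro sums_sum sums_mult flow_sums)
  moreover have "(\<Sum>j\<in>UNIV. A $ i $ j * ((((*v) A ^^ k) z $ j / fact k) * t ^ k))
      = ((*v) A ^^ k) (A *v z) $ i / fact k * t ^ k" for k
  proof -
    have "((*v) A ^^ k) (A *v z) = A *v ((*v) A ^^ k) z"
      using funpow_swap1[of "(*v) A" k z] by simp
    then show ?thesis
      by (simp add: matrix_vector_mult_def[of A "((*v) A ^^ k) z"] sum_divide_distrib sum_distrib_right sum_distrib_left mult_ac)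
  qed
  ultimately show "(A *v flow A t z) $ i = flow A t (A *v z) $ i"
    using flow_sums[of A "A *v z" i t] by (simp add: matrix_vector_mult_def sums_unique2)
qed

lemma has_vector_derivative_vec:
  fixes f :: "real \<Rightarrow> real^'n"
  assumes "\<And>i. ((\<lambda>t. f t $ i) has_vector_derivative f' $ i) (at t within S)"
  shows "(f has_vector_derivative f') (at t within S)"
  unfolding has_vector_derivative_def has_derivative_componentwise_within[of f]
  using assms by (auto simp: Basis_vec_def inner_axis has_vector_derivative_def)

text \<open>\<open>flow A t z\<close> is exp(tA) z, written componentwise as real power series in t
  so that termwise differentiation applies. \<open>diffs\<close> shifts the coefficients by one,
  which replaces z by \<open>A *v z\<close>; \<open>flow_commute\<close> then moves \<open>A\<close>
  outside.\<close>

lemma flow_has_vector_derivative: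
  fixes A :: "real^'n^'n"
  shows "((\<lambda>t. flow A t z) has_vector_derivative A *v flow A t z) (at t within S)"
proof (rule has_vector_derivative_vec)
  fix i
  let ?c = "\<lambda>k. ((*v) A ^^ k) z $ i / fact k"
  have "((\<lambda>t. \<Sum>k. ?c k * t ^ k) has_field_derivative (\<Sum>k. diffs ?c k * t ^ k)) (at t)"
    by (intro termdiffs_strong_converges_everywhere summable_flow)
  moreover have "diffs ?c k = ((*v) A ^^ k) (A *v z) $ i / fact k" for k
    by (simp add: diffs_def funpow_swap1 divide_simps del: of_nat_Suc)
  ultimately have "((\<lambda>t. flow A t z $ i) has_field_derivative flow A t (A *v z) $ i) (at t)"
    by (simp add: flow_def)
  then show "((\<lambda>t. flow A t z $ i) has_vector_derivative (A *v flow A t z) $ i) (at t within S)"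
    unfolding flow_commute
    by (metis DERIV_subset has_real_derivative_iff_has_vector_derivative top_greatest)
qed

lemma continuous_on_flow: "continuous_on S (\<lambda>t. flow A t z)" for A :: "real^'n^'n"
  unfolding continuous_on_eq_continuous_within
  by (intro ballI has_vector_derivative_continuous[OF flow_has_vector_derivative])

text \<open>
  The bound comes from the maximum \<open>m\<close> of \<open>exp (- 2 a s) |x s|\<close>: inserting it into the integral
  inequality gives \<open>m \<le> |x 0| + b t + m / 2\<close>.
\<close>
lemma gronwall_bound:
  fixes \<xi> f :: "real \<Rightarrow> 'a::euclidean_space"
  assumes sol: "\<And>s. s \<in> {0..t} \<Longrightarrow> (f has_integral (\<xi> s - \<xi> 0)) {0..s}"
    and bnd: "\<And>s. s \<in> {0..t} \<Longrightarrow> norm (f s) \<le> a * norm (\<xi> s) + b"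
    and a: "a > 0" and b: "b \<ge> 0" and s: "s \<in> {0..t}"
  shows "norm (\<xi> s) \<le> 2 * exp (2 * a * t) * (norm (\<xi> 0) + b * t)"
proof -
  have t: "0 \<le> t" using s by simp
  have int: "f integrable_on {0..t}"
    using sol[of t] t by (auto simp: integrable_on_def)
  have \<xi>: "\<xi> r = \<xi> 0 + integral {0..r} f" if "r \<in> {0..t}" for r
    using sol[OF that] by (simp add: integral_unique)
  have "continuous_on {0..t} (\<lambda>r. \<xi> 0 + integral {0..r} f)"
    by (intro continuous_intros indefinite_integral_continuous_1 int)
  then have cont: "continuous_on {0..t} \<xi>"
    by (rule continuous_on_eq) (rule \<xi>[symmetric])
  have "continuous_on {0..t} (\<lambda>r. exp (- (2 * a * r)) * norm (\<xi> r))"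
    by (intro continuous_intros cont)
  then obtain s' where s': "s' \<in> {0..t}"
    and mx: "\<And>r. r \<in> {0..t} \<Longrightarrow>
      exp (- (2 * a * r)) * norm (\<xi> r) \<le> exp (- (2 * a * s')) * norm (\<xi> s')"
    using continuous_attains_sup[of "{0..t}" "\<lambda>r. exp (- (2 * a * r)) * norm (\<xi> r)"] t by auto
  define m where "m = exp (- (2 * a * s')) * norm (\<xi> s')"
  have m0: "m \<ge> 0" by (simp add: m_def)
  have le: "norm (\<xi> r) \<le> exp (2 * a * r) * m" if "r \<in> {0..t}" for r
  proof -
    have "exp (2 * a * r) * (exp (- (2 * a * r)) * norm (\<xi> r)) \<le> exp (2 * a * r) * m"
      using mx[OF that] by (intro mult_left_mono) (auto simp: m_def)
    then show ?thesis by (simp add: exp_minus mult.assoc[symmetric])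
  qed
  \<comment> \<open>An antiderivative of the majorant of norm (f r). The rate 2a in the weight,
    instead of a, produces the factor 1/2 that lets m/2 be absorbed on the left.\<close>
  define G where "G r = m * exp (2 * a * r) / 2 + b * r" for r
  have G: "((\<lambda>r. a * (exp (2 * a * r) * m) + b) has_integral (G s' - G 0)) {0..s'}"
    unfolding G_def using s' a
    by (intro fundamental_theorem_of_calculus)
      (auto intro!: derivative_eq_intros simp flip: has_real_derivative_iff_has_vector_derivative)
  have "norm (\<xi> s' - \<xi> 0) \<le> G s' - G 0"
  proof -
    have "norm (integral {0..s'} f) \<le> integral {0..s'} (\<lambda>r. a * (exp (2 * a * r) * m) + b)"
    proof (rule integral_norm_bound_integral)
      show "f integrable_on {0..s'}" using sol[OF s'] by (auto simp: integrable_on_def)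
      show "(\<lambda>r. a * (exp (2 * a * r) * m) + b) integrable_on {0..s'}"
        using G by (auto simp: integrable_on_def)
      fix r assume "r \<in> {0..s'}"
      then have r: "r \<in> {0..t}" using s' by auto
      show "norm (f r) \<le> a * (exp (2 * a * r) * m) + b"
        using bnd[OF r] mult_left_mono[OF le[OF r] less_imp_le[OF a]] by linarith
    qed
    then show ?thesis
      using integral_unique[OF sol[OF s']] integral_unique[OF G] by simp
  qed
  moreover have "G s' - G 0 \<le> m * exp (2 * a * s') / 2 + b * t"
    using m0 s' b mult_left_mono[of s' t b] by (simp add: G_def)
  ultimately have "norm (\<xi> s') \<le> norm (\<xi> 0) + (m * exp (2 * a * s') / 2 + b * t)"
    using norm_triangle_ineq2[of "\<xi> s'" "\<xi> 0"] by linarith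
  then have "exp (- (2 * a * s')) * norm (\<xi> s')
      \<le> exp (- (2 * a * s')) * (norm (\<xi> 0) + b * t) + m / 2"
    using mult_left_mono[of "norm (\<xi> s')" "norm (\<xi> 0) + (m * exp (2 * a * s') / 2 + b * t)"
        "exp (- (2 * a * s'))"]
    by (simp add: exp_minus algebra_simps)
  moreover have "exp (- (2 * a * s')) * (norm (\<xi> 0) + b * t) \<le> 1 * (norm (\<xi> 0) + b * t)"
    using s' a b t by (intro mult_right_mono) auto
  ultimately have m: "m \<le> 2 * (norm (\<xi> 0) + b * t)"
    by (simp add: m_def)
  have "norm (\<xi> s) \<le> exp (2 * a * s) * m" by (rule le[OF s])
  also have "\<dots> \<le> exp (2 * a * t) * (2 * (norm (\<xi> 0) + b * t))"
    using s a m m0 by (intro mult_mono) auto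
  finally show ?thesis by (simp only: mult_ac)
qed

section \<open>Trajectories and steerable states\<close>

text \<open>The control constraint holds at every time and on an arbitrary interval, so that
  shifting, concatenating and superposing are pointwise operations. For bounded \<open>V\<close>
  this loses nothing against L1 controls; see \<open>trajectory_is_solution\<close> and
  \<open>solution_obtain_trajectory\<close>.\<close>

definition trajectory ::
  "real^'n^'n \<Rightarrow> real^'m^'n \<Rightarrow> (real^'m) set \<Rightarrow> real \<Rightarrow> real \<Rightarrow>
   (real \<Rightarrow> real^'m) \<Rightarrow> (real \<Rightarrow> real^'n) \<Rightarrow> bool" where
  "trajectory A B V a b u \<xi> \<longleftrightarrow>
     (\<forall>s\<in>{a..b}. u s \<in> V) \<and> u integrable_on {a..b} \<and>
     (\<forall>s\<in>{a..b}. ((\<lambda>r. A *v \<xi> r + B *v u r) has_integral (\<xi> s - \<xi> a)) {a..s})"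

lemma trajectoryD:
  assumes "trajectory A B V a b u \<xi>"
  shows "\<And>s. s \<in> {a..b} \<Longrightarrow> u s \<in> V" "u integrable_on {a..b}"
    "\<And>s. s \<in> {a..b} \<Longrightarrow> ((\<lambda>r. A *v \<xi> r + B *v u r) has_integral (\<xi> s - \<xi> a)) {a..s}"
  using assms by (auto simp: trajectory_def)

lemma trajectory_continuous:
  assumes "trajectory A B V a b u \<xi>"
  shows "continuous_on {a..b} \<xi>"
proof (cases "a \<le> b")
  case True
  let ?f = "\<lambda>r. A *v \<xi> r + B *v u r"
  have "?f integrable_on {a..b}"
    using trajectoryD(3)[OF assms, of b] True by (auto simp: integrable_on_def)
  then have "continuous_on {a..b} (\<lambda>r. \<xi> a + integral {a..r} ?f)"
    by (intro continuous_intros indefinite_integral_continuous_1)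
  moreover have "\<xi> a + integral {a..r} ?f = \<xi> r" if "r \<in> {a..b}" for r
    using integral_unique[OF trajectoryD(3)[OF assms that]] by simp
  ultimately show ?thesis
    by (rule continuous_on_eq)
qed simp

lemma trajectory_shift:
  assumes "trajectory A B V a b u \<xi>"
  shows "trajectory A B V (a + c) (b + c) (\<lambda>s. u (s - c)) (\<lambda>s. \<xi> (s - c))"
  unfolding trajectory_def
proof (intro conjI ballI)
  fix s assume s: "s \<in> {a + c..b + c}"
  then have s': "s - c \<in> {a..b}" by auto
  show "u (s - c) \<in> V" using trajectoryD(1)[OF assms s'] .
  show "((\<lambda>r. A *v \<xi> (r - c) + B *v u (r - c)) has_integral \<xi> (s - c) - \<xi> (a + c - c)) {a + c..s}"
    using has_integral_shift_real_ivl[OF trajectoryD(3)[OF assms s'], of "- c"] by simp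
next
  show "(\<lambda>s. u (s - c)) integrable_on {a + c..b + c}"
    using integrable_shift_real_ivl[OF trajectoryD(2)[OF assms], of "- c"] by simp
qed

lemma has_integral_spike_point:
  fixes f :: "real \<Rightarrow> 'a::euclidean_space"
  assumes "(f has_integral i) S" "\<And>x. x \<in> S \<Longrightarrow> x \<noteq> b \<Longrightarrow> g x = f x"
  shows "(g has_integral i) S"
  by (rule has_integral_spike[of "{b}" S g f]) (use assms in auto)

lemma trajectory_concat:
  assumes 1: "trajectory A B V a b u \<xi>" and 2: "trajectory A B V b c v \<eta>"
    and "a \<le> b" "b \<le> c" and eq: "\<xi> b = \<eta> b"
  shows "trajectory A B V a c (\<lambda>s. if s \<le> b then u s else v s) (\<lambda>s. if s \<le> b then \<xi> s else \<eta> s)"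
    (is "trajectory A B V a c ?w ?\<zeta>")
  unfolding trajectory_def
proof (intro conjI ballI)
  let ?f = "\<lambda>r. A *v ?\<zeta> r + B *v ?w r"
  have left: "(?f has_integral (\<xi> s - \<xi> a)) {a..s}" if "s \<in> {a..b}" for s
    using that by (intro has_integral_eq[OF _ trajectoryD(3)[OF 1 that]]) auto
  \<comment> \<open>At the junction the combined control keeps its left value, so the integrand on
    the right piece is altered at the single point \<open>b\<close>.\<close>
  have right: "(?f has_integral (\<eta> s - \<eta> b)) {b..s}" if "s \<in> {b..c}" for s
    using that eq by (intro has_integral_spike_point[OF trajectoryD(3)[OF 2 that], of b]) auto
  show "?w integrable_on {a..c}"
  proof (rule Henstock_Kurzweil_Integration.integrable_combine)
    show "?w integrable_on {a..b}"
      by (rule integrable_eq[OF trajectoryD(2)[OF 1]]) auto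
    obtain i where i: "(v has_integral i) {b..c}"
      using trajectoryD(2)[OF 2] by (auto simp: integrable_on_def)
    have "(?w has_integral i) {b..c}"
      by (rule has_integral_spike_point[OF i, of b]) auto
    then show "?w integrable_on {b..c}" by blast
  qed (use assms in auto)
  fix s assume s: "s \<in> {a..c}"
  show "?w s \<in> V"
    using s trajectoryD(1)[OF 1] trajectoryD(1)[OF 2] by auto
  show "(?f has_integral (?\<zeta> s - ?\<zeta> a)) {a..s}"
  proof (cases "s \<le> b")
    case True
    then show ?thesis using left[of s] s assms(3) by simp
  next
    case False
    have "(?f has_integral (\<xi> b - \<xi> a) + (\<eta> s - \<eta> b)) {a..s}"
      using False s assms(3) by (intro has_integral_combine[OF _ _ left right]) auto
    then show ?thesis using False eq assms(3) by simp
  qed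
qed

text \<open>Three independent control sets make one statement serve for convex combinations,
  scalings, the addition of a free motion (controls in {0}), differences of free motions, and
  translation by an equilibrium (controls in {w}).\<close>

lemma trajectory_linear_combination:
  assumes 1: "trajectory A B V a b u \<xi>" and 2: "trajectory A B V' a b v \<eta>"
    and "\<And>x y. x \<in> V \<Longrightarrow> y \<in> V' \<Longrightarrow> c *\<^sub>R x + d *\<^sub>R y \<in> V''"
  shows "trajectory A B V'' a b (\<lambda>s. c *\<^sub>R u s + d *\<^sub>R v s) (\<lambda>s. c *\<^sub>R \<xi> s + d *\<^sub>R \<eta> s)"
  unfolding trajectory_def
proof (intro conjI ballI)
  show "(\<lambda>s. c *\<^sub>R u s + d *\<^sub>R v s) integrable_on {a..b}"
    by (intro integrable_add integrable_cmul trajectoryD(2)[OF 1] trajectoryD(2)[OF 2])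
  fix s assume s: "s \<in> {a..b}"
  show "c *\<^sub>R u s + d *\<^sub>R v s \<in> V''"
    using assms(3) trajectoryD(1)[OF 1 s] trajectoryD(1)[OF 2 s] by blast
  have "((\<lambda>r. c *\<^sub>R (A *v \<xi> r + B *v u r) + d *\<^sub>R (A *v \<eta> r + B *v v r))
      has_integral (c *\<^sub>R (\<xi> s - \<xi> a) + d *\<^sub>R (\<eta> s - \<eta> a))) {a..s}"
    by (intro has_integral_add has_integral_cmul trajectoryD(3)[OF 1 s] trajectoryD(3)[OF 2 s])
  then show "((\<lambda>r. A *v (c *\<^sub>R \<xi> r + d *\<^sub>R \<eta> r) + B *v (c *\<^sub>R u r + d *\<^sub>R v r))
      has_integral (c *\<^sub>R \<xi> s + d *\<^sub>R \<eta> s - (c *\<^sub>R \<xi> a + d *\<^sub>R \<eta> a))) {a..s}"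
    by (simp add: matrix_vector_right_distrib matrix_vector_mult_scaleR algebra_simps)
qed

lemma trajectory_of_derivative:
  assumes "\<And>s. s \<in> {a..b} \<Longrightarrow>
      (\<xi> has_vector_derivative (A *v \<xi> s + B *v u s)) (at s within {a..b})"
    and "\<And>s. s \<in> {a..b} \<Longrightarrow> u s \<in> V" and "continuous_on {a..b} u"
  shows "trajectory A B V a b u \<xi>"
  unfolding trajectory_def
proof (intro conjI ballI)
  fix s assume s: "s \<in> {a..b}"
  show "((\<lambda>r. A *v \<xi> r + B *v u r) has_integral (\<xi> s - \<xi> a)) {a..s}"
    using s by (intro fundamental_theorem_of_calculus)
      (auto intro!: has_vector_derivative_within_subset[OF assms(1)])
qed (use assms in \<open>auto intro: integrable_continuous_real\<close>)

lemma trajectory_flow: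
  assumes "0 \<in> V"
  shows "trajectory A B V a b (\<lambda>_. 0) (\<lambda>s. flow A (s - c) z)"
proof (rule trajectory_of_derivative)
  fix s
  have "((\<lambda>s. flow A (s - c) z) has_vector_derivative 1 *\<^sub>R (A *v flow A (s - c) z)) (at s within {a..b})"
    by (rule vector_diff_chain_within[of "\<lambda>s. s - c" 1 s "{a..b}" "\<lambda>t. flow A t z", unfolded o_def])
      (auto intro!: derivative_eq_intros flow_has_vector_derivative)
  then show "((\<lambda>s. flow A (s - c) z) has_vector_derivative A *v flow A (s - c) z + B *v 0)
      (at s within {a..b})" by simp
qed (use assms in auto)

lemma trajectory_gronwall_bound:
  fixes A :: "real^'n^'n" and B :: "real^'m^'n"
  assumes "bounded V"
  shows "\<exists>a>0. \<exists>b\<ge>0. \<forall>t u \<xi> s. trajectory A B V 0 t u \<xi> \<longrightarrow> s \<in> {0..t} \<longrightarrow>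
    norm (\<xi> s) \<le> 2 * exp (2 * a * t) * (norm (\<xi> 0) + b * t)"
proof -
  obtain M where M: "\<And>v. v \<in> V \<Longrightarrow> norm v \<le> M" "M > 0"
    using assms by (auto simp: bounded_pos)
  \<comment> \<open>The summand 1 keeps the rate positive even for A = 0. Both constants depend on
    \<open>A\<close>, \<open>B\<close> and \<open>V\<close> only, not on the trajectory or its
    duration.\<close>
  let ?a = "onorm ((*v) A) + 1" and ?b = "onorm ((*v) B) * M"
  have a: "?a > 0" and b: "?b \<ge> 0"
    using onorm_pos_le[of "(*v) A"] onorm_pos_le[of "(*v) B"] M(2) by auto
  have "norm (\<xi> s) \<le> 2 * exp (2 * ?a * t) * (norm (\<xi> 0) + ?b * t)"
    if T: "trajectory A B V 0 t u \<xi>" and s: "s \<in> {0..t}" for t u \<xi> s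
  proof (rule gronwall_bound[OF trajectoryD(3)[OF T] _ a b s])
    fix s assume s: "s \<in> {0..t}"
    have "norm (A *v \<xi> s + B *v u s) \<le> onorm ((*v) A) * norm (\<xi> s) + onorm ((*v) B) * norm (u s)"
      by (intro norm_triangle_le add_mono norm_matrix_vector_mult_le)
    also have "\<dots> \<le> ?a * norm (\<xi> s) + ?b"
      using M(1)[OF trajectoryD(1)[OF T s]]
      by (intro add_mono mult_right_mono mult_left_mono) (auto simp: onorm_pos_le)
    finally show "norm (A *v \<xi> s + B *v u s) \<le> ?a * norm (\<xi> s) + ?b" .
  qed
  then show ?thesis using a b by blast
qed

lemma trajectory_unique_uncontrolled:
  fixes A :: "real^'n^'n" and B :: "real^'m^'n"
  assumes "trajectory A B {0} 0 t u \<xi>" "trajectory A B {0} 0 t v \<eta>" "\<xi> 0 = \<eta> 0" "0 \<le> t"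
  shows "\<xi> t = \<eta> t"
proof -
  let ?d = "\<lambda>s. 1 *\<^sub>R \<xi> s + (- 1) *\<^sub>R \<eta> s"
  have T: "trajectory A B {0} 0 t (\<lambda>s. 1 *\<^sub>R u s + (- 1) *\<^sub>R v s) ?d"
    by (rule trajectory_linear_combination[OF assms(1,2)]) auto
  have "norm (?d t) \<le> 2 * exp (2 * (onorm ((*v) A) + 1) * t) * (norm (?d 0) + 0 * t)"
  proof (rule gronwall_bound[OF trajectoryD(3)[OF T]])
    fix s assume s: "s \<in> {0..t}"
    have "norm (A *v ?d s + B *v (1 *\<^sub>R u s + (- 1) *\<^sub>R v s)) = norm (A *v ?d s)"
      using trajectoryD(1)[OF T s] by simp
    also have "\<dots> \<le> (onorm ((*v) A) + 1) * norm (?d s) + 0"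
      using norm_matrix_vector_mult_le[of A "?d s"] norm_ge_zero[of "?d s"]
      by (simp only: distrib_right mult_1 add_0_right)
    finally show "norm (A *v ?d s + B *v (1 *\<^sub>R u s + (- 1) *\<^sub>R v s))
      \<le> (onorm ((*v) A) + 1) * norm (?d s) + 0" .
  qed (use assms onorm_pos_le[of "(*v) A"] in auto)
  then show ?thesis using assms(3) by simp
qed

text \<open>Restarting from \<open>flow A (- h) z\<close> and following the time-shifted curve
  \<open>flow A (s - h) z\<close> give two uncontrolled trajectories with the same initial state;
  uniqueness identifies them at time h, so no product of series is needed. The zero input matrix
  merely makes the free system an instance of \<open>trajectory\<close>.\<close>

lemma flow_flow_minus:
  fixes A :: "real^'n^'n"
  assumes "h \<ge> 0"
  shows "flow A h (flow A (- h) z) = z"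
proof -
  have "trajectory A (0 :: real^'n^'n) {0} 0 h (\<lambda>_. 0) (\<lambda>s. flow A (s - 0) (flow A (- h) z))"
    and "trajectory A (0 :: real^'n^'n) {0} 0 h (\<lambda>_. 0) (\<lambda>s. flow A (s - h) z)"
    by (rule trajectory_flow, simp)+
  from trajectory_unique_uncontrolled[OF this] show ?thesis using assms by simp
qed

section \<open>States steerable to the origin\<close>

definition steerable ::
  "real^'n^'n \<Rightarrow> real^'m^'n \<Rightarrow> (real^'m) set \<Rightarrow> real \<Rightarrow> (real^'n) set" where
  "steerable A B V t = {z. \<exists>u \<xi>. trajectory A B V 0 t u \<xi> \<and> \<xi> 0 = z \<and> \<xi> t = 0}"

lemma steerable_concat:
  assumes 1: "trajectory A B V 0 h u \<xi>" and 2: "\<xi> h \<in> steerable A B V t" and "0 \<le> h" "0 \<le> t"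
  shows "\<xi> 0 \<in> steerable A B V (h + t)"
proof -
  obtain v \<eta> where \<eta>: "trajectory A B V 0 t v \<eta>" "\<eta> 0 = \<xi> h" "\<eta> t = 0"
    using 2 by (auto simp: steerable_def)
  have "trajectory A B V h (h + t) (\<lambda>s. v (s - h)) (\<lambda>s. \<eta> (s - h))"
    using trajectory_shift[OF \<eta>(1), of h] by (simp add: add.commute)
  from trajectory_concat[OF 1 this]
  have "trajectory A B V 0 (h + t) (\<lambda>s. if s \<le> h then u s else v (s - h))
      (\<lambda>s. if s \<le> h then \<xi> s else \<eta> (s - h))"
    using assms \<eta> by simp
  then show ?thesis
    unfolding steerable_def
    by (intro CollectI exI[of _ "\<lambda>s. if s \<le> h then u s else v (s - h)"]
        exI[of _ "\<lambda>s. if s \<le> h then \<xi> s else \<eta> (s - h)"]) (use assms \<eta> in auto)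
qed

lemma flow_zero_right [simp]: "flow A t 0 = 0" for A :: "real^'n^'n"
  by (rule linear_0[OF linear_flow])

lemma zero_in_steerable:
  assumes "0 \<in> V" shows "0 \<in> steerable A B V t"
  unfolding steerable_def
  using trajectory_flow[OF assms, of A B 0 t 0 0] by auto

text \<open>Once the origin is reached, the control 0 keeps the state there for the remaining
  time.\<close>

lemma steerable_mono:
  assumes "0 \<in> V" "0 \<le> s" "s \<le> t"
  shows "steerable A B V s \<subseteq> steerable A B V t"
proof
  fix z assume "z \<in> steerable A B V s"
  then obtain u \<xi> where \<xi>: "trajectory A B V 0 s u \<xi>" "\<xi> 0 = z" "\<xi> s = 0"
    by (auto simp: steerable_def)
  have "\<xi> 0 \<in> steerable A B V (s + (t - s))"
    by (rule steerable_concat[OF \<xi>(1)]) (use \<xi> assms zero_in_steerable in auto)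
  then show "z \<in> steerable A B V t" using \<xi> by simp
qed

lemma convex_steerable:
  assumes "convex V" shows "convex (steerable A B V t)"
  unfolding convex_def
proof (intro ballI allI impI)
  fix x y and c d :: real
  assume "x \<in> steerable A B V t" "y \<in> steerable A B V t" and cd: "0 \<le> c" "0 \<le> d" "c + d = 1"
  then obtain u \<xi> v \<eta> where "trajectory A B V 0 t u \<xi>" "\<xi> 0 = x" "\<xi> t = 0"
    and "trajectory A B V 0 t v \<eta>" "\<eta> 0 = y" "\<eta> t = 0"
    by (auto simp: steerable_def)
  moreover from this have "trajectory A B V 0 t (\<lambda>s. c *\<^sub>R u s + d *\<^sub>R v s) (\<lambda>s. c *\<^sub>R \<xi> s + d *\<^sub>R \<eta> s)"
    by (intro trajectory_linear_combination) (use assms cd in \<open>auto simp: convex_def\<close>)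
  ultimately show "c *\<^sub>R x + d *\<^sub>R y \<in> steerable A B V t"
    unfolding steerable_def by force
qed

lemma steerable_scale:
  assumes "\<And>v. v \<in> V \<Longrightarrow> c *\<^sub>R v \<in> V" and "z \<in> steerable A B V t"
  shows "c *\<^sub>R z \<in> steerable A B V t"
proof -
  obtain u \<xi> where \<xi>: "trajectory A B V 0 t u \<xi>" "\<xi> 0 = z" "\<xi> t = 0"
    using assms(2) by (auto simp: steerable_def)
  have "trajectory A B V 0 t (\<lambda>s. c *\<^sub>R u s + 0 *\<^sub>R u s) (\<lambda>s. c *\<^sub>R \<xi> s + 0 *\<^sub>R \<xi> s)"
    by (rule trajectory_linear_combination[OF \<xi>(1) \<xi>(1)]) (use assms in auto)
  then show ?thesis
    unfolding steerable_def using \<xi> by (auto intro!: exI)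
qed

lemma steerable_flow_back:
  assumes "z \<in> steerable A B V t" "0 \<in> V" "0 \<le> h" "0 \<le> t"
  shows "flow A (- h) z \<in> steerable A B V (h + t)"
  using steerable_concat[OF trajectory_flow[OF assms(2), of A B 0 h h z]] assms by simp

text \<open>Superposition with the uncontrolled system: the deviation \<open>y\<close> drifts and is removed later.\<close>
lemma steerable_add_drift:
  assumes "z \<in> steerable A B V t" "flow A t y \<in> steerable A B V t'" "0 \<le> t" "0 \<le> t'"
  shows "z + y \<in> steerable A B V (t + t')"
proof -
  obtain u \<xi> where \<xi>: "trajectory A B V 0 t u \<xi>" "\<xi> 0 = z" "\<xi> t = 0"
    using assms(1) by (auto simp: steerable_def)
  have "trajectory A B {0} 0 t (\<lambda>_. 0) (\<lambda>s. flow A (s - 0) y)"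
    by (rule trajectory_flow) simp
  from trajectory_linear_combination[OF \<xi>(1) this, of 1 1 V]
  have "trajectory A B V 0 t (\<lambda>s. 1 *\<^sub>R u s + 1 *\<^sub>R 0) (\<lambda>s. 1 *\<^sub>R \<xi> s + 1 *\<^sub>R flow A (s - 0) y)"
    by simp
  from steerable_concat[OF this, of t'] show ?thesis
    using assms \<xi> by simp
qed

text \<open>A basis of the span can be chosen among the steerable states; being finite, it is
  steerable in one common time t. The set for this t is convex, spans the same space and admits a
  small reflection: if |v| \<le> M on \<open>V\<close> and \<open>V\<close> contains the ball of
  radius e, scaling controls by -e/M stays in \<open>V\<close>. So 0 is a relative interior
  point.\<close>

lemma ball_subset_steerable_span:
  fixes A :: "real^'n^'n" and B :: "real^'m^'n"
  assumes V: "convex V" "bounded V" "0 \<in> interior V"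
  defines "Z \<equiv> \<Union>t\<in>{0..}. steerable A B V t"
  shows "\<exists>r>0. \<exists>t\<ge>0. ball 0 r \<inter> span Z \<subseteq> steerable A B V t"
proof -
  have V0: "0 \<in> V" using V(3) interior_subset by blast
  obtain e where e: "e > 0" "cball 0 e \<subseteq> V" using V(3) mem_interior_cball by blast
  obtain M where M: "M > 0" "\<And>v. v \<in> V \<Longrightarrow> norm v \<le> M" using V(2) by (auto simp: bounded_pos)
  obtain b where b: "b \<subseteq> Z" "independent b" "Z \<subseteq> span b"
    using maximal_independent_subset by blast
  have fin: "finite b" using b(2) by (rule independent_imp_finite)
  have "\<forall>z\<in>b. \<exists>t\<ge>0. z \<in> steerable A B V t" using b(1) by (auto simp: Z_def)
  then obtain \<theta> where \<theta>: "\<And>z. z \<in> b \<Longrightarrow> \<theta> z \<ge> 0 \<and> z \<in> steerable A B V (\<theta> z)" by metis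
  define t where "t = (\<Sum>z\<in>b. \<theta> z)"
  have t0: "t \<ge> 0" unfolding t_def using \<theta> by (auto intro: sum_nonneg)
  let ?S = "steerable A B V t"
  have bS: "b \<subseteq> ?S"
  proof
    fix z assume z: "z \<in> b"
    then have "\<theta> z \<le> t" unfolding t_def using \<theta> fin by (auto intro: member_le_sum)
    then show "z \<in> ?S" using steerable_mono[OF V0, of "\<theta> z" t A B] \<theta>[OF z] by blast
  qed
  have spS: "span ?S = span Z"
  proof (rule subset_antisym)
    show "span ?S \<subseteq> span Z" using t0 by (intro span_mono) (auto simp: Z_def)
    show "span Z \<subseteq> span ?S" by (meson b(3) bS order_trans span_minimal span_mono subspace_span)
  qed
  have S0: "0 \<in> ?S" by (rule zero_in_steerable[OF V0])
  have neg: "(- (e / M)) *\<^sub>R z \<in> ?S" if "z \<in> ?S" for z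
  proof (rule steerable_scale[OF _ that])
    fix v assume v: "v \<in> V"
    have "norm ((- (e / M)) *\<^sub>R v) \<le> e"
      using M(2)[OF v] M(1) e(1) by (simp add: field_simps)
    then show "(- (e / M)) *\<^sub>R v \<in> V" using e(2) by auto
  qed
  have "0 \<in> rel_interior ?S"
  proof (rule convex_rel_interior_iff[OF convex_steerable[OF V(1)], THEN iffD2])
    show "?S \<noteq> {}" using S0 by blast
    show "\<forall>x\<in>?S. \<exists>k>1. (1 - k) *\<^sub>R x + k *\<^sub>R 0 \<in> ?S"
    proof
      fix x assume "x \<in> ?S"
      from neg[OF this] show "\<exists>k>1. (1 - k) *\<^sub>R x + k *\<^sub>R 0 \<in> ?S"
        \<comment> \<open>With k = 1 + e/M the point to check is the reflected state -(e/M)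
          x.\<close>
        using e M by (intro exI[of _ "1 + e / M"]) simp
    qed
  qed
  then obtain r where "r > 0" "ball 0 r \<inter> affine hull ?S \<subseteq> ?S"
    by (auto simp: mem_rel_interior_ball)
  then show ?thesis using affine_hull_span_0[OF hull_inc[OF S0]] spS t0 by auto
qed

text \<open>Backward flow maps steerable states to steerable states, since drifting for time h
  undoes it. On the span this map is injective, hence onto by finite dimension, and its inverse is
  the forward flow.\<close>

lemma flow_in_span_steerable:
  fixes A :: "real^'n^'n" and B :: "real^'m^'n"
  assumes V0: "0 \<in> V" and h: "h \<ge> 0"
  defines "Z \<equiv> \<Union>t\<in>{0..}. steerable A B V t"
  assumes y: "y \<in> span Z"
  shows "flow A h y \<in> span Z" and "flow A (- h) y \<in> span Z"
proof -
  have sub: "flow A (- h) ` span Z \<subseteq> span Z"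
  proof -
    have "flow A (- h) ` Z \<subseteq> Z"
    proof (intro image_subsetI)
      fix z assume "z \<in> Z"
      then obtain t where "t \<ge> 0" "z \<in> steerable A B V t" by (auto simp: Z_def)
      then have "flow A (- h) z \<in> steerable A B V (h + t)" "h + t \<ge> 0"
        using steerable_flow_back V0 h by auto
      then show "flow A (- h) z \<in> Z" unfolding Z_def by (intro UN_I[of "h + t"]) auto
    qed
    then have "span (flow A (- h) ` Z) \<subseteq> span Z" by (rule span_mono)
    then show ?thesis by (simp add: linear_span_image[OF linear_flow])
  qed
  then show "flow A (- h) y \<in> span Z" using y by blast
  have inj: "inj_on (flow A (- h)) (span Z)"
    by (metis flow_flow_minus[OF h] inj_onI)
  have "dim (flow A (- h) ` span Z) = dim (span Z)"
    by (rule dim_image_eq[OF linear_flow]) (simp only: span_span inj)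
  then have "flow A (- h) ` span Z = span Z"
    using sub by (intro subspace_dim_equal linear_subspace_image[OF linear_flow]) auto
  then obtain z where "z \<in> span Z" "y = flow A (- h) z" using y by blast
  then show "flow A h y \<in> span Z" by (simp add: flow_flow_minus[OF h])
qed

text \<open>Write y = x + (y - x). While x is steered to 0 in time t, the deviation drifts to
  \<open>flow A t (y - x)\<close>, which lies in the span and, for |y - x| < r/K with K a bound for
  the flow at time t, in the ball of states steerable in time s.\<close>

lemma steerable_locally_bounded_time:
  fixes A :: "real^'n^'n" and B :: "real^'m^'n"
  assumes V: "convex V" "bounded V" "0 \<in> interior V"
  defines "Z \<equiv> \<Union>t\<in>{0..}. steerable A B V t"
  assumes x: "x \<in> Z"
  shows "\<exists>d>0. \<exists>s\<ge>0. \<forall>y\<in>span Z. dist x y < d \<longrightarrow> y \<in> steerable A B V s"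
proof -
  have V0: "0 \<in> V" using V(3) interior_subset by blast
  obtain t where t: "t \<ge> 0" "x \<in> steerable A B V t" using x by (auto simp: Z_def)
  obtain r s where r: "r > 0" "s \<ge> 0" "ball 0 r \<inter> span Z \<subseteq> steerable A B V s"
    using ball_subset_steerable_span[OF V, of A B] by (auto simp: Z_def)
  obtain K where K: "K > 0" "\<And>y. norm (flow A t y) \<le> norm y * K"
    using bounded_linear.pos_bounded[OF linear_flow[of A t, unfolded linear_conv_bounded_linear]]
    by blast
  have "y \<in> steerable A B V (t + s)" if y: "y \<in> span Z" "dist x y < r / K" for y
  proof -
    have "norm (flow A t (y - x)) < r"
      using K(2)[of "y - x"] K(1) y(2) by (simp add: dist_norm norm_minus_commute field_simps)
    moreover have "y - x \<in> span Z" using y x by (simp add: span_base span_diff)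
    ultimately have "flow A t (y - x) \<in> steerable A B V s"
      using r(3) flow_in_span_steerable(1)[OF V0 t(1), of "y - x" A B] by (auto simp: Z_def)
    from steerable_add_drift[OF t(2) this t(1) r(2)] show ?thesis by simp
  qed
  then show ?thesis using r K t by (intro exI[of _ "r / K"] conjI exI[of _ "t + s"]) auto
qed

text \<open>
  The majorant is \<open>2 / d\<close>, where \<open>d x\<close> is the supremum of all \<open>\<delta> \<le> 1\<close> such that the points
  of \<open>X\<close> within \<open>\<delta>\<close> of \<open>x\<close> lie in \<open>C (1 / \<delta>)\<close>; this \<open>d\<close> is Lipschitz.
\<close>
lemma continuous_majorant_of_locally_bounded:
  fixes C :: "real \<Rightarrow> 'a::metric_space set"
  assumes mono: "\<And>s t. 0 \<le> s \<Longrightarrow> s \<le> t \<Longrightarrow> C s \<subseteq> C t"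
    and loc: "\<And>x. x \<in> X \<Longrightarrow> \<exists>d>0. \<exists>s\<ge>0. \<forall>y\<in>X. dist x y < d \<longrightarrow> y \<in> C s"
  shows "\<exists>\<tau>. continuous_on X \<tau> \<and> (\<forall>x\<in>X. 0 \<le> \<tau> x \<and> x \<in> C (\<tau> x))"
proof -
  define P where "P x \<delta> \<longleftrightarrow> 0 < \<delta> \<and> \<delta> \<le> 1 \<and> (\<forall>y\<in>X. dist x y < \<delta> \<longrightarrow> y \<in> C (1 / \<delta>))" for x \<delta>
  define d where "d x = Sup {\<delta>. P x \<delta>}" for x
  have bdd: "bdd_above {\<delta>. P x \<delta>}" for x
    by (rule bdd_aboveI[of _ 1]) (auto simp: P_def)
  have ex: "\<exists>\<delta>. P x \<delta>" if x: "x \<in> X" for x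
  proof -
    obtain e s where e: "e > 0" "s \<ge> 0" and es: "\<And>y. y \<in> X \<Longrightarrow> dist x y < e \<Longrightarrow> y \<in> C s"
      using loc[OF x] by blast
    \<comment> \<open>The last term ensures s \<le> 1/\<delta>; the summand 1 covers s = 0.\<close>
    define \<delta> where "\<delta> = min (min 1 e) (1 / (s + 1))"
    have \<delta>: "0 < \<delta>" "\<delta> \<le> 1" "\<delta> \<le> e" "\<delta> \<le> 1 / (s + 1)" using e by (auto simp: \<delta>_def)
    then have "s \<le> 1 / \<delta>" using e by (simp add: field_simps)
    then have "P x \<delta>" using \<delta> es mono[OF e(2)] by (force simp: P_def)
    then show ?thesis ..
  qed
  have dpos: "d x > 0" if "x \<in> X" for x
    using ex[OF that] cSup_upper[OF _ bdd[of x]] unfolding d_def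
    by (metis P_def mem_Collect_eq order_less_le_trans)
  have lip: "d x \<le> d y + dist x y" if x: "x \<in> X" and y: "y \<in> X" for x y
    unfolding d_def[of x]
  proof (rule cSup_least)
    show "{\<delta>. P x \<delta>} \<noteq> {}" using ex[OF x] by auto
    fix \<delta> assume "\<delta> \<in> {\<delta>. P x \<delta>}"
    then have \<delta>: "P x \<delta>" by simp
    show "\<delta> \<le> d y + dist x y"
    proof (cases "dist x y < \<delta>")
      case True
      let ?e = "\<delta> - dist x y"
      have "P y ?e"
        unfolding P_def
      proof (intro conjI ballI impI)
        show "0 < ?e" using True by simp
        show "?e \<le> 1" using \<delta> zero_le_dist[of x y] unfolding P_def by linarith
        fix z assume z: "z \<in> X" "dist y z < ?e"
        then have "dist x z < \<delta>" using dist_triangle[of x z y] by linarith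
        then have "z \<in> C (1 / \<delta>)" using \<delta> z by (auto simp: P_def)
        moreover have "1 / \<delta> \<le> 1 / ?e" using True \<delta> by (intro divide_left_mono) (auto simp: P_def)
        ultimately show "z \<in> C (1 / ?e)" using mono[of "1 / \<delta>" "1 / ?e"] \<delta> by (auto simp: P_def)
      qed
      then have "?e \<le> d y" unfolding d_def by (intro cSup_upper bdd) auto
      then show ?thesis by simp
    next
      case False
      then show ?thesis using dpos[OF y] by simp
    qed
  qed
  have "continuous_on X d"
    unfolding continuous_on_iff
  proof (intro ballI allI impI)
    fix x and e :: real assume x: "x \<in> X" and "e > 0"
    moreover have "dist (d y) (d x) \<le> dist y x" if "y \<in> X" for y
      using lip[OF x that] lip[OF that x] by (auto simp: dist_real_def dist_commute abs_le_iff)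
    ultimately show "\<exists>\<delta>>0. \<forall>y\<in>X. dist y x < \<delta> \<longrightarrow> dist (d y) (d x) < e"
      by (intro exI[of _ e]) (auto intro: order_le_less_trans)
  qed
  then have "continuous_on X (\<lambda>x. 2 / d x)"
    using dpos by (intro continuous_intros) force+
  moreover have "x \<in> C (2 / d x)" if x: "x \<in> X" for x
  proof -
    \<comment> \<open>The supremum need not be attained, but some admissible \<delta> exceeds half
      of it: the origin of the factor 2 in the majorant.\<close>
    obtain \<delta> where \<delta>: "P x \<delta>" "d x / 2 < \<delta>"
      using less_cSup_iff[OF _ bdd[of x], of "d x / 2"] ex[OF x] dpos[OF x] by (auto simp: d_def)
    then have "x \<in> C (1 / \<delta>)" "0 < \<delta>" using x by (auto simp: P_def)
    moreover have "1 / \<delta> \<le> 2 / d x" using \<delta>(2) dpos[OF x] \<open>0 < \<delta>\<close> by (simp add: field_simps)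
    ultimately show ?thesis using mono[of "1 / \<delta>" "2 / d x"] by auto
  qed
  ultimately show ?thesis
    using dpos by (intro exI[of _ "\<lambda>x. 2 / d x"]) (auto simp: less_imp_le)
qed

lemma steerable_continuous_time:
  fixes A :: "real^'n^'n" and B :: "real^'m^'n"
  assumes V: "convex V" "bounded V" "0 \<in> interior V"
  defines "Z \<equiv> \<Union>t\<in>{0..}. steerable A B V t"
  shows "\<exists>\<tau>. continuous_on Z \<tau> \<and> (\<forall>x\<in>Z. 0 \<le> \<tau> x \<and> x \<in> steerable A B V (\<tau> x))"
proof (rule continuous_majorant_of_locally_bounded)
  show "steerable A B V s \<subseteq> steerable A B V t" if "0 \<le> s" "s \<le> t" for s t
    using steerable_mono[OF _ that] V(3) interior_subset by blast
  show "\<exists>d>0. \<exists>s\<ge>0. \<forall>y\<in>Z. dist x y < d \<longrightarrow> y \<in> steerable A B V s" if "x \<in> Z" for x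
    using steerable_locally_bounded_time[OF V, of x A B] that span_superset[of Z]
    unfolding Z_def by (meson subsetD)
qed

section \<open>Controllability\<close>

text \<open>Turns orthogonality to a curve in a subspace into orthogonality to its initial velocity.
  One-sided, because the steering curves used below are parametrized by nonnegative
  durations.\<close>

lemma one_sided_derivative_orthogonal:
  fixes f :: "real \<Rightarrow> 'a::euclidean_space"
  assumes "(f has_vector_derivative f') (at 0 within {0..})"
    and "\<And>t. t \<ge> 0 \<Longrightarrow> p \<bullet> f t = 0"
  shows "p \<bullet> f' = 0"
proof -
  have "((\<lambda>t. p \<bullet> f t) has_vector_derivative p \<bullet> f') (at 0 within {0..})"
    using bounded_linear.has_vector_derivative[OF bounded_linear_inner_right assms(1)] .
  then have "((\<lambda>t. 0) has_vector_derivative p \<bullet> f') (at 0 within {0..})"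
    by (rule has_vector_derivative_transform[rotated 2]) (use assms(2) in auto)
  moreover have "((\<lambda>t. 0::real) has_vector_derivative 0) (at 0 within {0..})"
    by (rule has_vector_derivative_const)
  moreover have "at (0::real) within {0..} \<noteq> bot"
    by (simp add: at_within_Ici_at_right trivial_limit_at_right_real)
  ultimately show ?thesis
    by (metis vector_derivative_unique_within)
qed

text \<open>Variation of constants: the constant control w brings to 0 in time t exactly the state
  minus the integral of exp(-rA) B w over [0,t]. The trajectory is the same expression with t - s in
  place of t.\<close>

lemma steerable_constant_control:
  fixes A :: "real^'n^'n" and B :: "real^'m^'n"
  assumes "w \<in> V" "0 \<le> t"
  shows "- integral {0..t} (\<lambda>r. flow A (- r) (B *v w)) \<in> steerable A B V t"
proof -
  let ?f = "\<lambda>r. flow A (- r) (B *v w)"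
  let ?\<theta> = "\<lambda>r. integral {0..r} ?f"
  have d: "(?f has_vector_derivative - (A *v ?f r)) (at r within S)" for r S
  proof -
    have "(?f has_vector_derivative (- 1) *\<^sub>R (A *v ?f r)) (at r within S)"
      by (rule vector_diff_chain_within[of "\<lambda>r. - r" "- 1" r S "\<lambda>t. flow A t (B *v w)", unfolded o_def])
        (auto intro!: derivative_eq_intros flow_has_vector_derivative)
    then show ?thesis by simp
  qed
  have cont: "continuous_on S ?f" for S
    unfolding continuous_on_eq_continuous_within
    by (intro ballI has_vector_derivative_continuous[OF d])
  \<comment> \<open>Integrating the derivative of exp(-rA) B w; the identity is the differential
    equation for \<open>- ?\<theta> (t - s)\<close> under the control w.\<close>
  have fixpoint: "A *v ?\<theta> r = B *v w - ?f r" if "r \<ge> 0" for r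
  proof -
    have "((\<lambda>r. - (A *v ?f r)) has_integral (?f r - ?f 0)) {0..r}"
      by (intro fundamental_theorem_of_calculus that d)
    moreover have "((\<lambda>r. - (A *v ?f r)) has_integral - (A *v ?\<theta> r)) {0..r}"
      by (intro has_integral_neg has_integral_linear[OF integrable_integral, unfolded o_def]
          integrable_continuous_real cont matrix_vector_mul_bounded_linear)
    ultimately have "?f r - ?f 0 = - (A *v ?\<theta> r)" by (rule has_integral_unique)
    then show ?thesis by (simp add: algebra_simps)
  qed
  have "trajectory A B V 0 t (\<lambda>_. w) (\<lambda>s. - ?\<theta> (t - s))"
  proof (rule trajectory_of_derivative)
    fix s assume s: "s \<in> {0..t}"
    have "(?\<theta> has_vector_derivative ?f (t - s)) (at (t - s) within {0..t})"
      by (rule integral_has_vector_derivative[OF cont]) (use s in auto)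
    then have "((\<lambda>s. ?\<theta> (t - s)) has_vector_derivative (- 1) *\<^sub>R ?f (t - s)) (at s within {0..t})"
      by (intro vector_diff_chain_within[of "\<lambda>s. t - s" "- 1" s "{0..t}" ?\<theta>, unfolded o_def])
        (auto intro!: derivative_eq_intros elim: has_vector_derivative_within_subset)
    from has_vector_derivative_minus[OF this]
    have "((\<lambda>s. - ?\<theta> (t - s)) has_vector_derivative ?f (t - s)) (at s within {0..t})" by simp
    moreover have "A *v (- ?\<theta> (t - s)) + B *v w = ?f (t - s)"
      using fixpoint[of "t - s"] s by (simp add: linear_neg[OF matrix_vector_mul_linear])
    ultimately show "((\<lambda>s. - ?\<theta> (t - s)) has_vector_derivative A *v (- ?\<theta> (t - s)) + B *v w)
        (at s within {0..t})" by simp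
  qed (use assms in auto)
  then show ?thesis unfolding steerable_def by force
qed

text \<open>The span is invariant under \<open>A\<close>, as the initial velocity of the flow inside
  it, and contains the range of \<open>B\<close>, as the initial velocity of the states from
  \<open>steerable_constant_control\<close>. It therefore contains every column of the Kalman
  matrix, whose rank is n.\<close>

lemma span_steerable_eq_UNIV:
  fixes A :: "real^'n^'n" and B :: "real^'m^'n"
  assumes "controllable A B" and V: "0 \<in> interior V"
  shows "span (\<Union>t\<in>{0..}. steerable A B V t) = UNIV" (is "span ?Z = UNIV")
proof -
  have V0: "0 \<in> V" using V interior_subset by blast
  obtain e where e: "e > 0" "cball 0 e \<subseteq> V" using V mem_interior_cball by blast
  \<comment> \<open>Membership in a subspace is tested on its orthogonal complement, so that
    derivatives can be handled through scalar products.\<close>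
  have in_span: "x \<in> span ?Z" if "\<And>p. (\<And>z. z \<in> span ?Z \<Longrightarrow> p \<bullet> z = 0) \<Longrightarrow> p \<bullet> x = 0" for x
  proof -
    obtain y z where yz: "y \<in> span ?Z" "\<And>w. w \<in> span ?Z \<Longrightarrow> orthogonal z w" "x = y + z"
      using orthogonal_subspace_decomp_exists[of ?Z x] by blast
    then have "z \<bullet> x = 0" by (intro that) (auto simp: orthogonal_def)
    moreover have "z \<bullet> y = 0" using yz by (auto simp: orthogonal_def)
    ultimately have "z = 0" using yz(3) by (simp add: inner_add_right)
    then show ?thesis using yz by simp
  qed
  have A_inv: "A *v z \<in> span ?Z" if z: "z \<in> span ?Z" for z
  proof (rule in_span)
    fix p assume p: "\<And>z. z \<in> span ?Z \<Longrightarrow> p \<bullet> z = 0"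
    have "p \<bullet> (A *v flow A 0 z) = 0"
      by (rule one_sided_derivative_orthogonal[OF flow_has_vector_derivative])
        (use p flow_in_span_steerable(1)[OF V0 _ z] in auto)
    then show "p \<bullet> (A *v z) = 0" by simp
  qed
  have B_small: "B *v w \<in> span ?Z" if w: "w \<in> V" for w
  proof (rule in_span)
    fix p assume p: "\<And>z. z \<in> span ?Z \<Longrightarrow> p \<bullet> z = 0"
    let ?f = "\<lambda>r. flow A (- r) (B *v w)"
    have cont: "continuous_on S ?f" for S
      by (rule continuous_on_compose2[OF continuous_on_flow[of UNIV], of S uminus])
        (auto intro: continuous_intros)
    have "((\<lambda>r. integral {0..r} ?f) has_vector_derivative ?f 0) (at 0 within {0..1})"
      by (rule integral_has_vector_derivative[OF cont]) auto
    then have "((\<lambda>r. integral {0..r} ?f) has_vector_derivative ?f 0) (at 0 within {0..})"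
      unfolding has_vector_derivative_def
      by (subst at_within_nhd[of 0 "{..<1}" "{0..}" "{0..1}"]) auto
    then have "p \<bullet> ?f 0 = 0"
    proof (rule one_sided_derivative_orthogonal)
      fix t :: real assume t: "t \<ge> 0"
      have "- integral {0..t} ?f \<in> ?Z"
        using t by (intro UN_I[of t] steerable_constant_control[OF w t]) simp
      then have "p \<bullet> (- integral {0..t} ?f) = 0" by (intro p span_base)
      then show "p \<bullet> integral {0..t} ?f = 0" by simp
    qed
    then show "p \<bullet> (B *v w) = 0" by simp
  qed
  have B_all: "B *v w \<in> span ?Z" for w
  proof (cases "w = 0")
    case False
    have "(e / norm w) *\<^sub>R w \<in> V" using e False by auto
    from span_scale[OF B_small[OF this], of "norm w / e"] show ?thesis
      using False e by (simp add: matrix_vector_mult_scaleR)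
  qed (simp add: span_0)
  have pow: "(((**) A ^^ k) B) *v w \<in> span ?Z" for k w
  proof (induction k)
    case (Suc k)
    show ?case
      using A_inv[OF Suc] by (simp add: matrix_vector_mul_assoc)
  qed (simp add: B_all)
  have "kalman_matrix A B *v x \<in> span ?Z" for x
  proof -
    have "kalman_matrix A B *v x = (\<Sum>q\<in>UNIV. x $ q *\<^sub>R column q (kalman_matrix A B))"
      by (simp add: matrix_mult_sum scalar_mult_eq_scaleR)
    moreover have "column q (kalman_matrix A B) =
        (((**) A ^^ to_nat_on (UNIV :: 'n set) (fst q)) B) *v axis (snd q) 1" for q
      by (simp add: kalman_matrix_def column_def matrix_vector_mult_basis)
    ultimately show ?thesis by (simp only: span_sum span_scale pow)
  qed
  then have "range (\<lambda>x. kalman_matrix A B *v x) \<subseteq> span ?Z" by auto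
  from dim_subset[OF this] have "CARD('n) \<le> dim ?Z"
    using assms(1) unfolding controllable_def rank_dim_range dim_span by linarith
  then have "dim ?Z = DIM(real^'n)"
    using dim_subset_UNIV[of ?Z] by simp
  then show ?thesis by (simp only: dim_eq_full)
qed

section \<open>Positive semidefinite matrices and the adjoint flow\<close>

lemma inner_matrix_transpose: "(A *v x) \<bullet> y = x \<bullet> (transpose A *v y)" for A :: "real^'n^'m"
  using dot_lmul_matrix[of x "transpose A" y] by simp

lemma matrix_vector_mult_uminus: "(- A) *v x = - (A *v x)" for A :: "real^'n^'m"
  by (simp add: matrix_vector_mult_def vec_eq_iff sum_negf)

lemma psd_symmetric: "psd M \<Longrightarrow> (M *v x) \<bullet> y = x \<bullet> (M *v y)"
  by (simp add: psd_def inner_matrix_transpose)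

text \<open>Perturb v against w = Mv: the form at v - tw is t^2 k - 2t |w|^2, which is negative for
  small t > 0 unless w = 0. The choice t = |w|^2 / (k + 1) is small enough and avoids dividing by k
  = 0.\<close>

lemma psd_null_vector:
  assumes "psd M" "v \<bullet> (M *v v) = 0"
  shows "M *v v = 0"
proof -
  define w where "w = M *v v"
  define k where "k = w \<bullet> (M *v w)"
  define t where "t = (w \<bullet> w) / (k + 1)"
  have k: "k \<ge> 0" using assms(1) by (simp add: psd_def k_def)
  have "0 \<le> (v - t *\<^sub>R w) \<bullet> (M *v (v - t *\<^sub>R w))"
    using assms(1) by (simp add: psd_def)
  also have "\<dots> = t * (t * k) - 2 * t * (w \<bullet> w)"
    using assms(2) psd_symmetric[OF assms(1), of v w]
    by (simp add: matrix_vector_mult_diff_distrib matrix_vector_mult_scaleR inner_diff_left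
        inner_diff_right algebra_simps flip: w_def k_def)
  finally have *: "2 * t * (w \<bullet> w) \<le> t * (t * k)" by simp
  have "w \<bullet> w \<le> 0"
  proof (rule ccontr)
    assume "\<not> w \<bullet> w \<le> 0"
    then have pos: "w \<bullet> w > 0" by linarith
    then have t: "t > 0" using k by (simp add: t_def)
    then have "2 * (w \<bullet> w) \<le> t * k" using * by (simp add: mult.assoc)
    also have "\<dots> \<le> t * (k + 1)" using t by simp
    also have "\<dots> = w \<bullet> w" using k by (simp add: t_def)
    finally show False using pos by linarith
  qed
  then have "w \<bullet> w = 0" using inner_ge_zero[of w] by linarith
  then show ?thesis by (simp add: w_def)
qed

lemma convex_Union_steerable:
  assumes "convex V" "0 \<in> V"
  shows "convex (\<Union>t\<in>{0..}. steerable A B V t)"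
  unfolding convex_def
proof (intro ballI allI impI)
  fix x y and c d :: real
  assume "x \<in> (\<Union>t\<in>{0..}. steerable A B V t)" "y \<in> (\<Union>t\<in>{0..}. steerable A B V t)"
    and cd: "0 \<le> c" "0 \<le> d" "c + d = 1"
  then obtain s t where st: "s \<ge> 0" "x \<in> steerable A B V s" "t \<ge> 0" "y \<in> steerable A B V t"
    by auto
  then have "x \<in> steerable A B V (max s t)" "y \<in> steerable A B V (max s t)"
    using steerable_mono[OF assms(2), of _ "max s t" A B] by (auto simp: subset_iff)
  then have "c *\<^sub>R x + d *\<^sub>R y \<in> steerable A B V (max s t)"
    using convexD[OF convex_steerable[OF assms(1)] _ _ cd] by blast
  then show "c *\<^sub>R x + d *\<^sub>R y \<in> (\<Union>t\<in>{0..}. steerable A B V t)"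
    using st(1) by (intro UN_I[of "max s t"]) auto
qed

text \<open>\<open>adj\<close> says that N is minus the transpose of \<open>A\<close>, so the
  pairing of solutions of the two free systems is constant in time; its values at 0 and h are the
  two sides.\<close>

lemma flow_adjoint:
  fixes A N :: "real^'n^'n"
  assumes adj: "\<And>x y. (N *v x) \<bullet> y + x \<bullet> (A *v y) = 0" and "h \<ge> 0"
  shows "p \<bullet> flow A (- h) y = flow N h p \<bullet> y"
proof -
  let ?c = "\<lambda>s. flow N s p \<bullet> flow A s (flow A (- h) y)"
  have "(?c has_vector_derivative
      flow N s p \<bullet> (A *v flow A s (flow A (- h) y)) + (N *v flow N s p) \<bullet> flow A s (flow A (- h) y)) (at s)"
    for s
    by (rule bounded_bilinear.has_vector_derivative[OF bounded_bilinear_inner])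
      (rule flow_has_vector_derivative)+
  then have "DERIV ?c s :> 0" for s
    using adj by (simp add: has_real_derivative_iff_has_vector_derivative add.commute)
  then have "?c 0 = ?c h" by (intro DERIV_isconst_all) auto
  then show ?thesis using flow_flow_minus[OF assms(2), of A y] by simp
qed

text \<open>
  Otherwise a hyperplane with normal \<open>p\<close> bounds the steerable states. Then the adjoint state
  \<open>q\<close> with \<open>q 0 = p\<close> and \<open>q' = Q (J + R) q\<close> tends to zero, so \<open>p\<close> lies in the range of \<open>Q\<close>; but
  \<open>q \<bullet> Q\<^sup>+ q\<close> is nonnegative and nondecreasing, hence zero.
\<close>
lemma all_states_steerable:
  fixes J R Q :: "real^'n^'n" and B :: "real^'m^'n"
  assumes J: "J = - transpose J" and R: "psd R" and Q: "psd Q"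
    and V: "convex V" "bounded V" "0 \<in> interior V"
    and ctrl: "controllable ((J - R) ** Q) B"
  shows "(\<Union>t\<in>{0..}. steerable ((J - R) ** Q) B V t) = UNIV"
proof (rule ccontr)
  let ?A = "(J - R) ** Q"
  define Z where "Z = (\<Union>t\<in>{0..}. steerable ?A B V t)"
  assume "(\<Union>t\<in>{0..}. steerable ?A B V t) \<noteq> UNIV"
  then obtain x where x: "x \<notin> Z" unfolding Z_def by blast
  have V0: "0 \<in> V" using V(3) interior_subset by blast
  have ZI: "z \<in> Z" if "z \<in> steerable ?A B V t" "t \<ge> 0" for z t
    unfolding Z_def using that by auto
  have "0 \<in> Z" using ZI[OF zero_in_steerable[OF V0], of 0] by simp
  then have "Z \<noteq> {}" by blast
  have "convex Z" unfolding Z_def by (rule convex_Union_steerable[OF V(1) V0])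
  obtain p c where p: "p \<noteq> 0" "\<And>z. z \<in> Z \<Longrightarrow> p \<bullet> z \<le> c"
    using separating_hyperplane_sets[OF \<open>convex Z\<close> convex_singleton[of x] \<open>Z \<noteq> {}\<close>] x by auto
  obtain r t0 where r: "r > 0" "t0 \<ge> 0" "ball 0 r \<subseteq> steerable ?A B V t0"
    using ball_subset_steerable_span[OF V, of ?A B]
    unfolding span_steerable_eq_UNIV[OF ctrl V(3)] Int_UNIV_right by (elim exE conjE) metis
  define N where "N = Q ** (J + R)"
  define q where "q h = flow N h p" for h
  have Jskew: "(J *v a) \<bullet> b = - (a \<bullet> (J *v b))" for a b
  proof -
    have "transpose J = - J" using J by (metis minus_minus)
    then show ?thesis
      by (simp add: inner_matrix_transpose matrix_vector_mult_uminus)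
  qed
  have adj: "(N *v a) \<bullet> b + a \<bullet> (?A *v b) = 0" for a b
  proof -
    have "(N *v a) \<bullet> b = ((J + R) *v a) \<bullet> (Q *v b)"
      by (simp add: N_def psd_symmetric[OF Q] flip: matrix_vector_mul_assoc)
    also have "\<dots> = - (a \<bullet> (J *v (Q *v b))) + a \<bullet> (R *v (Q *v b))"
      by (simp add: matrix_vector_mult_add_rdistrib inner_add_left Jskew psd_symmetric[OF R])
    also have "\<dots> = - (a \<bullet> (?A *v b))"
      by (simp add: matrix_vector_mult_diff_rdistrib inner_diff_right flip: matrix_vector_mul_assoc)
    finally show ?thesis by simp
  qed
  have dq: "(q has_vector_derivative N *v q h) (at h)" for h
    unfolding q_def by (rule flow_has_vector_derivative)
  \<comment> \<open>Take z in \<open>Z\<close> with p-value within (r/2) e of the supremum. For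
    large h, adding \<open>flow ?A (- h) y\<close> with |y| = r/2 in the direction of q h stays in
    \<open>Z\<close>; by the adjoint identity it raises the p-value by (r/2) |q h|, which is thus
    below (r/2) e.\<close>
  have small: "\<exists>t. \<forall>h\<ge>t. norm (q h) < e" if e: "e > 0" for e
  proof -
    let ?s = "SUP z\<in>Z. p \<bullet> z"
    have bdd: "bdd_above ((\<bullet>) p ` Z)" by (rule bdd_aboveI[of _ c]) (use p in auto)
    have "?s - r / 2 * e < ?s" using r e by simp
    then obtain z where z: "z \<in> Z" "?s - r / 2 * e < p \<bullet> z"
      using less_cSUP_iff[OF \<open>Z \<noteq> {}\<close> bdd] by blast
    then obtain t where t: "t \<ge> 0" "z \<in> steerable ?A B V t" by (auto simp: Z_def)
    have "norm (q h) < e" if h: "h \<ge> t" for h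
    proof (cases "q h = 0")
      case False
      define y where "y = (r / 2 / norm (q h)) *\<^sub>R q h"
      have "norm y < r" using False r by (simp add: y_def)
      then have y: "y \<in> steerable ?A B V t0" using r by auto
      have h0: "h \<ge> 0" using t h by simp
      have "z \<in> steerable ?A B V h" using steerable_mono[OF V0 t(1) h] t(2) by blast
      moreover have "flow ?A h (flow ?A (- h) y) \<in> steerable ?A B V t0"
        using y by (simp add: flow_flow_minus[OF h0])
      ultimately have "z + flow ?A (- h) y \<in> steerable ?A B V (h + t0)"
        using steerable_add_drift h0 r(2) by blast
      then have "z + flow ?A (- h) y \<in> Z" using ZI h0 r(2) by simp
      then have "p \<bullet> (z + flow ?A (- h) y) \<le> ?s" by (intro cSUP_upper bdd)
      then have "p \<bullet> flow ?A (- h) y < r / 2 * e" using z(2) by (simp add: inner_add_right)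
      moreover have "p \<bullet> flow ?A (- h) y = r / 2 * norm (q h)"
        unfolding flow_adjoint[OF adj h0] using False
        by (simp add: y_def q_def[symmetric] dot_square_norm power2_eq_square)
      ultimately show ?thesis using r by simp
    qed (use e in simp)
    then show ?thesis by blast
  qed
  then have lim: "(q \<longlongrightarrow> 0) at_top"
    by (auto simp: tendsto_iff eventually_at_top_linorder)
  \<comment> \<open>\<open>N\<close> maps into the range of \<open>Q\<close>, so the component of q
    along a kernel vector of \<open>Q\<close> is conserved; as q tends to 0, it vanishes.\<close>
  have orth: "n \<bullet> q h = 0" if n: "Q *v n = 0" for n h
  proof -
    have "((\<lambda>h. n \<bullet> q h) has_vector_derivative n \<bullet> (N *v q h)) (at h)" for h
      using bounded_linear.has_vector_derivative[OF bounded_linear_inner_right dq] .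
    moreover have "n \<bullet> (N *v q h) = 0" for h
      using psd_symmetric[OF Q, of n "(J + R) *v q h"] n
      by (simp add: N_def flip: matrix_vector_mul_assoc)
    ultimately have "DERIV (\<lambda>h. n \<bullet> q h) h :> 0" for h
      by (simp add: has_real_derivative_iff_has_vector_derivative)
    then have const: "n \<bullet> q h' = n \<bullet> q h" for h' by (intro DERIV_isconst_all) auto
    have "((\<lambda>h. n \<bullet> q h) \<longlongrightarrow> n \<bullet> 0) at_top" by (intro tendsto_intros lim)
    moreover have "(\<lambda>h'. n \<bullet> q h') = (\<lambda>_. n \<bullet> q h)" by (rule ext) (rule const)
    ultimately have "((\<lambda>_. n \<bullet> q h) \<longlongrightarrow> n \<bullet> 0) (at_top :: real filter)" by metis
    then show ?thesis by (simp add: tendsto_const_iff)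
  qed
  \<comment> \<open>A linear right inverse of \<open>Q\<close> on its range stands in for the
    pseudoinverse.\<close>
  obtain g where g: "linear g" "\<And>v. v \<in> range ((*v) Q) \<Longrightarrow> Q *v g v = v"
    using linear_exists_right_inverse_on[OF matrix_vector_mul_linear[of Q] subspace_UNIV]
    by (elim exE conjE) metis
  have inrange: "y \<in> range ((*v) Q)" if y: "\<And>n. Q *v n = 0 \<Longrightarrow> n \<bullet> y = 0" for y
  proof -
    have sub: "span (range ((*v) Q)) = range ((*v) Q)"
      using linear_subspace_image[OF matrix_vector_mul_linear[of Q] subspace_UNIV] by simp
    obtain a b where ab: "a \<in> range ((*v) Q)" "\<And>w. w \<in> range ((*v) Q) \<Longrightarrow> orthogonal b w" "y = a + b"
      using orthogonal_subspace_decomp_exists[of "range ((*v) Q)" y] unfolding sub by blast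
    have "(Q *v b) \<bullet> (Q *v b) = b \<bullet> (Q *v (Q *v b))" by (rule psd_symmetric[OF Q])
    also have "\<dots> = 0" using ab(2) by (auto simp: orthogonal_def)
    finally have "b \<bullet> y = 0" using y by simp
    moreover have "b \<bullet> a = 0" using ab(1,2) by (auto simp: orthogonal_def)
    ultimately have "b = 0" using ab(3) by (simp add: inner_add_right)
    then show ?thesis using ab by simp
  qed
  have Qg: "Q *v g (q h) = q h" for h using g(2)[OF inrange] orth by blast
  have g': "bounded_linear g" using g(1) by (simp add: linear_conv_bounded_linear)
  define E where "E h = q h \<bullet> g (q h)" for h
  \<comment> \<open>The skew part J contributes nothing and \<open>R\<close> appears twice, because
    q \<bullet> g(Nq) and Nq \<bullet> g(q) agree by symmetry of \<open>Q\<close>.\<close>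
  have dE: "DERIV E h :> 2 * (q h \<bullet> (R *v q h))" for h
  proof -
    let ?w = "(J + R) *v q h"
    have N: "N *v q h = Q *v ?w" by (simp add: N_def flip: matrix_vector_mul_assoc)
    have "(E has_vector_derivative (q h \<bullet> g (N *v q h) + (N *v q h) \<bullet> g (q h))) (at h)"
      unfolding E_def
      by (rule bounded_bilinear.has_vector_derivative[OF bounded_bilinear_inner dq
            bounded_linear.has_vector_derivative[OF g' dq]])
    moreover have "(N *v q h) \<bullet> g (q h) = ?w \<bullet> q h"
      using psd_symmetric[OF Q, of ?w "g (q h)"] by (simp add: N Qg)
    moreover have "q h \<bullet> g (N *v q h) = (N *v q h) \<bullet> g (q h)"
    proof -
      have "Q *v g (N *v q h) = N *v q h" using g(2) N by auto
      then show ?thesis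
        using psd_symmetric[OF Q, of "g (q h)" "g (N *v q h)"] by (simp add: Qg inner_commute)
    qed
    moreover have "?w \<bullet> q h = q h \<bullet> (R *v q h)"
      using Jskew[of "q h" "q h"] psd_symmetric[OF R, of "q h" "q h"]
      by (simp add: matrix_vector_mult_add_rdistrib inner_add_left inner_add_right inner_commute)
    ultimately show ?thesis by (simp add: has_real_derivative_iff_has_vector_derivative)
  qed
  have Rq: "0 \<le> 2 * (q h \<bullet> (R *v q h))" for h using R by (simp add: psd_def)
  have "E 0 \<le> E h" if "h \<ge> 0" for h
    by (rule DERIV_nonneg_imp_nondecreasing[OF that]) (metis dE Rq)
  moreover have "(E \<longlongrightarrow> 0 \<bullet> g 0) at_top"
    unfolding E_def by (intro tendsto_intros lim bounded_linear.tendsto[OF g'])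
  \<comment> \<open>\<open>E\<close> is nondecreasing with limit 0, so E 0 \<le> 0. As E 0 is also
    the value of the form of \<open>Q\<close> at g (q 0), this forces q 0 = p = 0.\<close>
  ultimately have "E 0 \<le> 0 \<bullet> g 0"
    by (intro tendsto_lowerbound[of E _ at_top]) (auto simp: eventually_at_top_linorder)
  then have "g (q 0) \<bullet> (Q *v g (q 0)) \<le> 0" by (simp add: E_def Qg inner_commute)
  moreover have "0 \<le> g (q 0) \<bullet> (Q *v g (q 0))" using Q by (simp add: psd_def)
  ultimately have "Q *v g (q 0) = 0" by (intro psd_null_vector[OF Q]) linarith
  then show False using p(1) by (simp add: Qg) (simp add: q_def)
qed

section \<open>Energy balance and dissipation\<close>

text \<open>On the unit sphere of the orthogonal complement of the kernel the form is positive,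
  hence at least some m > 0 by compactness. Splitting w = k + r orthogonally, homogeneity gives the
  bound with \<kappa> = 1/m.\<close>

lemma infdist_ker_le:
  fixes W :: "real^'k^'k"
  assumes W: "psd W"
  shows "\<exists>\<kappa>>0. \<forall>w. (infdist w (ker W))\<^sup>2 \<le> \<kappa> * (w \<bullet> (W *v w))"
proof -
  let ?S = "sphere 0 1 \<inter> (\<Inter>k\<in>ker W. {r. k \<bullet> r = 0})"
  have comp: "compact ?S"
    by (intro compact_Int_closed compact_sphere closed_INT ballI closed_hyperplane)
  have sub: "subspace (ker W)"
    by (simp add: ker_def subspace_def matrix_vector_right_distrib matrix_vector_mult_scaleR)
  have pos: "r \<bullet> (W *v r) > 0" if r: "r \<in> ?S" for r
  proof -
    have "r \<bullet> (W *v r) \<noteq> 0"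
    proof
      assume "r \<bullet> (W *v r) = 0"
      then have "r \<in> ker W" using psd_null_vector[OF W] by (simp add: ker_def)
      then show False using r by auto
    qed
    then show ?thesis using W by (simp add: psd_def order_less_le)
  qed
  have "\<exists>m>0. \<forall>r\<in>?S. m \<le> r \<bullet> (W *v r)"
  proof (cases "?S = {}")
    case False
    have "continuous_on ?S (\<lambda>r. r \<bullet> (W *v r))" by (intro continuous_intros)
    then obtain r0 where "r0 \<in> ?S" "\<forall>r\<in>?S. r0 \<bullet> (W *v r0) \<le> r \<bullet> (W *v r)"
      using continuous_attains_inf[OF comp False] by blast
    then show ?thesis using pos by blast
  qed (auto intro: exI[of _ 1])
  then obtain m where m: "m > 0" "\<And>r. r \<in> ?S \<Longrightarrow> m \<le> r \<bullet> (W *v r)" by blast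
  have "(infdist w (ker W))\<^sup>2 \<le> 1 / m * (w \<bullet> (W *v w))" for w
  proof -
    obtain k r where kr: "k \<in> ker W" "\<And>x. x \<in> ker W \<Longrightarrow> orthogonal r x" "w = k + r"
      using orthogonal_subspace_decomp_exists[of "ker W" w] span_eq_iff[THEN iffD2, OF sub] by metis
    have Wk: "W *v k = 0" using kr(1) by (simp add: ker_def)
    have eq: "w \<bullet> (W *v w) = r \<bullet> (W *v r)"
      using psd_symmetric[OF W, of k r] Wk
      by (simp add: kr(3) matrix_vector_right_distrib inner_add_left)
    have "infdist w (ker W) \<le> norm r"
      using infdist_le[OF kr(1), of w] by (simp add: kr(3) dist_norm)
    then have "(infdist w (ker W))\<^sup>2 \<le> (norm r)\<^sup>2"
      by (intro power_mono infdist_nonneg)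
    also have "m * (norm r)\<^sup>2 \<le> r \<bullet> (W *v r)"
    proof (cases "r = 0")
      case False
      have "m \<le> (r /\<^sub>R norm r) \<bullet> (W *v (r /\<^sub>R norm r))"
        using False kr(2) by (intro m(2)) (auto simp: orthogonal_def inner_commute)
      also have "\<dots> = (r \<bullet> (W *v r)) / (norm r)\<^sup>2"
        by (simp add: matrix_vector_mult_scaleR power2_eq_square field_simps)
      finally show ?thesis using False by (simp add: field_simps)
    qed simp
    then have "(norm r)\<^sup>2 \<le> 1 / m * (w \<bullet> (W *v w))" using m(1) eq by (simp add: field_simps)
    finally show ?thesis .
  qed
  then show ?thesis using m(1) by (intro exI[of _ "1 / m"]) auto
qed

lemma continuous_on_matrix_vector_mult [continuous_intros]:
  "continuous_on S f \<Longrightarrow> continuous_on S (\<lambda>x. A *v f x)" for A :: "real^'n^'k"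
  by (rule bounded_linear.continuous_on[OF matrix_vector_mul_bounded_linear])

text \<open>The pair (state, control) is measurable with values in a compact set, on which
  \<open>G\<close> is bounded. This one fact covers the control, the dynamics, the energy rate, the
  dissipation and the distance to the kernel.\<close>

lemma trajectory_absolutely_integrable:
  fixes G :: "real^'n \<Rightarrow> real^'m \<Rightarrow> 'c::euclidean_space"
  assumes T: "trajectory A B V a b u \<xi>" and "bounded V"
    and G: "continuous_on UNIV (\<lambda>p. G (fst p) (snd p))"
  shows "(\<lambda>s. G (\<xi> s) (u s)) absolutely_integrable_on {a..b}"
proof -
  have "compact (\<xi> ` {a..b} \<times> closure V)"
    using assms(2) by (intro compact_Times compact_continuous_image trajectory_continuous[OF T]) auto
  then have "bounded ((\<lambda>p. G (fst p) (snd p)) ` (\<xi> ` {a..b} \<times> closure V))"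
    by (intro compact_imp_bounded compact_continuous_image continuous_on_subset[OF G]) auto
  then obtain K where K: "\<And>p. p \<in> \<xi> ` {a..b} \<times> closure V \<Longrightarrow> norm (G (fst p) (snd p)) \<le> K"
    unfolding bounded_iff by blast
  have "\<xi> \<in> borel_measurable (lebesgue_on {a..b})"
    by (intro continuous_imp_measurable_on_sets_lebesgue trajectory_continuous[OF T]) auto
  moreover have "u \<in> borel_measurable (lebesgue_on {a..b})"
    by (rule integrable_imp_measurable[OF trajectoryD(2)[OF T]])
  ultimately have "(\<lambda>s. (\<xi> s, u s)) \<in> borel_measurable (lebesgue_on {a..b})"
    by (rule borel_measurable_Pair)
  from measurable_compose[OF this borel_measurable_continuous_onI[OF G]]
  have "(\<lambda>s. G (\<xi> s) (u s)) \<in> borel_measurable (lebesgue_on {a..b})" by simp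
  then show ?thesis
  proof (rule measurable_bounded_by_integrable_imp_absolutely_integrable)
    show "(\<lambda>_. K) integrable_on {a..b}" by (rule integrable_const_ivl)
    fix s assume s: "s \<in> {a..b}"
    show "norm (G (\<xi> s) (u s)) \<le> K"
      using K[of "(\<xi> s, u s)"] trajectoryD(1)[OF T s] closure_subset[of V] s by auto
  qed simp
qed

lemma continuous_on_linear_dynamics: "continuous_on S (\<lambda>p. A *v fst p + B *v snd p)"
  for A :: "real^'n^'k" and B :: "real^'m^'k"
  by (intro continuous_intros)

lemma has_integral_subinterval_difference:
  fixes f :: "real \<Rightarrow> 'a::banach"
  assumes "(f has_integral i) {a..s}" "(f has_integral j) {a..t}" "a \<le> s" "s \<le> t"
  shows "(f has_integral (j - i)) {s..t}"
proof -
  have "f integrable_on {s..t}"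
    by (rule integrable_on_subinterval[OF has_integral_integrable[OF assms(2)]]) (use assms(3) in simp)
  then have k: "(f has_integral integral {s..t} f) {s..t}" by (rule integrable_integral)
  have "j = i + integral {s..t} f"
    by (rule has_integral_unique[OF assms(2) has_integral_combine[OF assms(3,4,1) k]])
  then show ?thesis using k by simp
qed

text \<open>
  Controls are only integrable, so \<open>\<xi>\<close> need not be differentiable. But \<open>\<xi>\<close> is Lipschitz, hence the
  difference of both sides, as a function of the upper limit, has increments of second order.
\<close>
lemma trajectory_energy:
  fixes A Q :: "real^'n^'n" and B :: "real^'m^'n"
  assumes T: "trajectory A B V 0 t u \<xi>" and V: "bounded V" and Q: "psd Q" and t: "0 \<le> t"
  shows "((\<lambda>s. (Q *v \<xi> s) \<bullet> (A *v \<xi> s + B *v u s)) has_integral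
    (\<xi> t \<bullet> (Q *v \<xi> t) / 2 - \<xi> 0 \<bullet> (Q *v \<xi> 0) / 2)) {0..t}"
proof -
  define f where "f s = A *v \<xi> s + B *v u s" for s
  define g where "g s = (Q *v \<xi> s) \<bullet> f s" for s
  have f: "(f has_integral (\<xi> s - \<xi> 0)) {0..s}" if "s \<in> {0..t}" for s
    unfolding f_def using trajectoryD(3)[OF T that] .
  have "(\<lambda>s. (Q *v \<xi> s) \<bullet> (A *v \<xi> s + B *v u s)) absolutely_integrable_on {0..t}"
    by (rule trajectory_absolutely_integrable[OF T V, where G = "\<lambda>x u. (Q *v x) \<bullet> (A *v x + B *v u)"])
      (intro continuous_intros)
  then have gint: "g integrable_on {0..t}"
    unfolding g_def f_def by (rule set_lebesgue_integral_eq_integral(1))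
  obtain X where X: "\<And>s. s \<in> {0..t} \<Longrightarrow> norm (\<xi> s) \<le> X"
    using compact_imp_bounded[OF compact_continuous_image[OF trajectory_continuous[OF T] compact_Icc]]
    unfolding bounded_iff by blast
  obtain Y where Y: "\<And>v. v \<in> V \<Longrightarrow> norm v \<le> Y" using V unfolding bounded_iff by blast
  define M where "M = onorm ((*v) A) * X + onorm ((*v) B) * Y"
  have fM: "norm (f s) \<le> M" if s: "s \<in> {0..t}" for s
  proof -
    have "norm (f s) \<le> onorm ((*v) A) * norm (\<xi> s) + onorm ((*v) B) * norm (u s)"
      unfolding f_def by (intro norm_triangle_le add_mono norm_matrix_vector_mult_le)
    also have "\<dots> \<le> M"
      unfolding M_def using X[OF s] Y[OF trajectoryD(1)[OF T s]]
      by (intro add_mono mult_left_mono) (auto simp: onorm_pos_le)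
    finally show ?thesis .
  qed
  have M0: "0 \<le> M" using fM[of 0] t norm_ge_zero[of "f 0"] by (metis atLeastAtMost_iff order.refl order_trans)
  define k where "k = onorm ((*v) Q)"
  have k0: "0 \<le> k" unfolding k_def by (simp add: onorm_pos_le)
  define G where "G s = \<xi> s \<bullet> (Q *v \<xi> s) / 2 - integral {0..s} g" for s
  \<comment> \<open>2 k M^2 covers two remainders, each at most k M^2 (s - r)^2; the summand 1 makes
    \<open>C\<close> positive, so that e / C can serve as radius below.\<close>
  define C where "C = 2 * k * M\<^sup>2 + 1"
  have incr: "\<bar>G s - G r\<bar> \<le> C * (s - r)\<^sup>2" if rs: "0 \<le> r" "r \<le> s" "s \<le> t" for r s
  proof -
    define \<Delta> where "\<Delta> = \<xi> s - \<xi> r"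
    have lip: "norm (\<xi> s' - \<xi> r) \<le> M * (s' - r)" if "r \<le> s'" "s' \<le> s" for s'
    proof -
      have "(f has_integral ((\<xi> s' - \<xi> 0) - (\<xi> r - \<xi> 0))) {r..s'}"
        by (rule has_integral_subinterval_difference[OF f f]) (use that rs in auto)
      then have "norm ((\<xi> s' - \<xi> 0) - (\<xi> r - \<xi> 0)) \<le> M * (s' - r)"
        using has_integral_bound[of M f _ r s'] fM that rs M0 by auto
      then show ?thesis by simp
    qed
    have f\<Delta>: "(f has_integral \<Delta>) {r..s}"
      using has_integral_subinterval_difference[OF f f, of r s] rs by (simp add: \<Delta>_def)
    have "(g has_integral (integral {0..s} g - integral {0..r} g)) {r..s}"
      by (rule has_integral_subinterval_difference[of g _ 0])
        (use rs gint in \<open>auto intro!: integrable_integral intro: integrable_on_subinterval\<close>)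
    moreover have "((\<lambda>s'. (Q *v \<xi> r) \<bullet> f s') has_integral (Q *v \<xi> r) \<bullet> \<Delta>) {r..s}"
      using has_integral_linear[OF f\<Delta> bounded_linear_inner_right] by (simp add: o_def)
    ultimately have "((\<lambda>s'. g s' - (Q *v \<xi> r) \<bullet> f s') has_integral
        (integral {0..s} g - integral {0..r} g - (Q *v \<xi> r) \<bullet> \<Delta>)) {r..s}"
      by (rule has_integral_diff)
    then have "norm (integral {0..s} g - integral {0..r} g - (Q *v \<xi> r) \<bullet> \<Delta>)
        \<le> (k * (M * (s - r)) * M) * measure lborel {r..s}"
    proof (rule has_integral_bound[where 'a = real, unfolded box_real, rotated])
      show "0 \<le> k * (M * (s - r)) * M" using k0 M0 rs by simp
      fix s' assume s': "s' \<in> {r..s}"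
      \<comment> \<open>The state in the first factor is frozen at r; the error is the Lipschitz
        increment of the state, hence the extra factor s - r.\<close>
      have "g s' - (Q *v \<xi> r) \<bullet> f s' = (Q *v (\<xi> s' - \<xi> r)) \<bullet> f s'"
        by (simp add: g_def matrix_vector_mult_diff_distrib inner_diff_left)
      then have "norm (g s' - (Q *v \<xi> r) \<bullet> f s') \<le> norm (Q *v (\<xi> s' - \<xi> r)) * norm (f s')"
        by (simp add: Cauchy_Schwarz_ineq2)
      also have "\<dots> \<le> (k * norm (\<xi> s' - \<xi> r)) * norm (f s')"
        unfolding k_def by (intro mult_right_mono norm_matrix_vector_mult_le) simp
      also have "\<dots> \<le> (k * (M * (s - r))) * M"
      proof (intro mult_mono)
        show "norm (\<xi> s' - \<xi> r) \<le> M * (s - r)"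
          using lip[of s'] s' mult_left_mono[of "s' - r" "s - r" M] M0 by auto
        show "norm (f s') \<le> M" using fM[of s'] s' rs by auto
      qed (use k0 M0 rs in auto)
      finally show "norm (g s' - (Q *v \<xi> r) \<bullet> f s') \<le> k * (M * (s - r)) * M" .
    qed
    then have 1: "\<bar>integral {0..s} g - integral {0..r} g - (Q *v \<xi> r) \<bullet> \<Delta>\<bar> \<le> k * M\<^sup>2 * (s - r)\<^sup>2"
      using rs by (simp add: power2_eq_square mult_ac)
    have "\<xi> s = \<xi> r + \<Delta>" by (simp add: \<Delta>_def)
    then have 2: "\<xi> s \<bullet> (Q *v \<xi> s) / 2 - \<xi> r \<bullet> (Q *v \<xi> r) / 2 = (Q *v \<xi> r) \<bullet> \<Delta> + \<Delta> \<bullet> (Q *v \<Delta>) / 2"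
      using psd_symmetric[OF Q, of \<Delta> "\<xi> r"]
      by (simp add: matrix_vector_right_distrib inner_add_left inner_add_right inner_commute field_simps)
    have "\<bar>\<Delta> \<bullet> (Q *v \<Delta>)\<bar> \<le> norm \<Delta> * (k * norm \<Delta>)"
      unfolding k_def
      by (rule order_trans[OF Cauchy_Schwarz_ineq2]) (intro mult_left_mono norm_matrix_vector_mult_le, simp)
    also have "\<dots> \<le> (M * (s - r)) * (k * (M * (s - r)))"
      using lip[of s] rs k0 M0 by (intro mult_mono) (auto simp: \<Delta>_def)
    finally have 3: "\<bar>\<Delta> \<bullet> (Q *v \<Delta>)\<bar> \<le> k * M\<^sup>2 * (s - r)\<^sup>2"
      by (simp add: power2_eq_square mult_ac)
    have "G s - G r = \<Delta> \<bullet> (Q *v \<Delta>) / 2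
        - (integral {0..s} g - integral {0..r} g - (Q *v \<xi> r) \<bullet> \<Delta>)"
      using 2 by (simp add: G_def)
    also have "\<bar>\<dots>\<bar> \<le> 2 * (k * M\<^sup>2 * (s - r)\<^sup>2)" using 1 3 by linarith
    also have "\<dots> \<le> C * (s - r)\<^sup>2" by (simp add: C_def algebra_simps)
    finally show ?thesis .
  qed
  have C0: "C > 0" using k0 by (simp add: C_def add_nonneg_pos)
  have "\<exists>c. \<forall>s\<in>{0..t}. G s = c"
  proof (rule has_derivative_zero_constant)
    fix r assume r: "r \<in> {0..t}"
    show "(G has_derivative (\<lambda>h. 0)) (at r within {0..t})"
      unfolding has_derivative_within_alt
    proof (intro conjI allI impI)
      fix e :: real assume e: "e > 0"
      show "\<exists>d>0. \<forall>y\<in>{0..t}. norm (y - r) < d \<longrightarrow> norm (G y - G r - 0) \<le> e * norm (y - r)"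
      proof (intro exI[of _ "e / C"] conjI ballI impI)
        show "e / C > 0" using e C0 by simp
        fix y assume y: "y \<in> {0..t}" "norm (y - r) < e / C"
        have "\<bar>G y - G r\<bar> \<le> C * \<bar>y - r\<bar>\<^sup>2"
          using incr[of r y] incr[of y r] y r
          by (cases "r \<le> y") (auto simp: abs_minus_commute power2_commute)
        also have "\<dots> = (C * \<bar>y - r\<bar>) * \<bar>y - r\<bar>" by (simp add: power2_eq_square)
        also have "\<dots> \<le> e * \<bar>y - r\<bar>"
          using y(2) C0 by (intro mult_right_mono) (auto simp: field_simps)
        finally show "norm (G y - G r - 0) \<le> e * norm (y - r)" by simp
      qed
    qed simp
  qed simp
  then have "G t = G 0" using t by auto
  then have "integral {0..t} g = \<xi> t \<bullet> (Q *v \<xi> t) / 2 - \<xi> 0 \<bullet> (Q *v \<xi> 0) / 2"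
    by (simp add: G_def)
  then show ?thesis using integrable_integral[OF gint] by (simp add: g_def[abs_def] f_def)
qed

lemma trajectory_concat_cost:
  fixes l :: "real^'n \<Rightarrow> real^'m \<Rightarrow> real"
  assumes 1: "trajectory A B V a b u \<xi>" and 2: "trajectory A B V b c v \<eta>"
    and ab: "a \<le> b" "b \<le> c" and eq: "\<xi> b = \<eta> b"
    and i: "((\<lambda>s. l (\<xi> s) (u s)) has_integral i) {a..b}"
    and j: "((\<lambda>s. l (\<eta> s) (v s)) has_integral j) {b..c}"
  shows "\<exists>w \<zeta>. trajectory A B V a c w \<zeta> \<and> \<zeta> a = \<xi> a \<and> \<zeta> c = \<eta> c \<and>
    ((\<lambda>s. l (\<zeta> s) (w s)) has_integral (i + j)) {a..c}"
proof (intro exI conjI)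
  let ?w = "\<lambda>s. if s \<le> b then u s else v s" and ?\<zeta> = "\<lambda>s. if s \<le> b then \<xi> s else \<eta> s"
  show "trajectory A B V a c ?w ?\<zeta>" by (rule trajectory_concat[OF 1 2 ab eq])
  show "?\<zeta> a = \<xi> a" "?\<zeta> c = \<eta> c" using ab eq by auto
  have "((\<lambda>s. l (?\<zeta> s) (?w s)) has_integral i) {a..b}"
    by (rule has_integral_eq[OF _ i]) auto
  moreover have "((\<lambda>s. l (?\<zeta> s) (?w s)) has_integral j) {b..c}"
    by (rule has_integral_spike_point[OF j, of b]) auto
  ultimately show "((\<lambda>s. l (?\<zeta> s) (?w s)) has_integral (i + j)) {a..c}"
    by (rule has_integral_combine[OF ab])
qed

section \<open>Passage between L1 controls and trajectories\<close>

lemma trajectory_is_solution: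
  assumes T: "trajectory A B U 0 t u \<xi>" and U: "bounded U"
  shows "u \<in> L1_controls t U" "is_solution A B t u \<xi>"
proof -
  have "u absolutely_integrable_on {0..t}"
    using trajectory_absolutely_integrable[OF T U, of "\<lambda>x u. u"] by (simp add: continuous_on_snd)
  then show "u \<in> L1_controls t U"
    using trajectoryD(1)[OF T] by (auto simp: L1_controls_def)
  have "(\<lambda>s. A *v \<xi> s + B *v u s) absolutely_integrable_on {0..t}"
    by (rule trajectory_absolutely_integrable[OF T U, of "\<lambda>x u. A *v x + B *v u"])
      (rule continuous_on_linear_dynamics)
  then show "is_solution A B t u \<xi>"
    using integral_unique[OF trajectoryD(3)[OF T]] by (simp add: is_solution_def)
qed

text \<open>The control is reset to w on the null set where it leaves \<open>U\<close>. No integral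
  changes, so the state stays the same function.\<close>

lemma solution_obtain_trajectory:
  assumes u: "u \<in> L1_controls t U" and sol: "is_solution A B t u \<xi>" and w: "w \<in> U"
  obtains v N where "trajectory A B U 0 t v \<xi>" "negligible N" "\<And>s. s \<in> {0..t} - N \<Longrightarrow> v s = u s"
proof -
  obtain N where N: "{s \<in> space lebesgue. \<not> (s \<in> {0..t} \<longrightarrow> u s \<in> U)} \<subseteq> N"
      "emeasure lebesgue N = 0" "N \<in> sets lebesgue"
    using u unfolding L1_controls_def by (auto elim: AE_E)
  define v where "v s = (if s \<in> {0..t} \<longrightarrow> u s \<in> U then u s else w)" for s
  have neg: "negligible N" using N by (simp add: negligible_iff_null_sets null_setsI)
  have vu: "v s = u s" if "s \<notin> N" for s using N(1) that by (auto simp: v_def)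
  have "trajectory A B U 0 t v \<xi>"
    unfolding trajectory_def
  proof (intro conjI ballI)
    show "v integrable_on {0..t}"
    proof (rule integrable_spike[OF _ neg])
      show "u integrable_on {0..t}"
        using u by (intro set_lebesgue_integral_eq_integral(1)) (simp add: L1_controls_def)
    qed (simp add: vu)
    fix s assume s: "s \<in> {0..t}"
    show "v s \<in> U" using s w by (auto simp: v_def)
    let ?f = "\<lambda>r. A *v \<xi> r + B *v u r"
    have "?f integrable_on {0..t}"
      using sol by (intro set_lebesgue_integral_eq_integral(1)) (simp add: is_solution_def)
    then have "?f integrable_on {0..s}" by (rule integrable_on_subinterval) (use s in auto)
    then have "(?f has_integral (integral {0..s} ?f)) {0..s}" by (rule integrable_integral)
    moreover have "\<xi> s = \<xi> 0 + integral {0..s} ?f"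
      using sol s unfolding is_solution_def by (elim conjE) (rule bspec)
    then have "integral {0..s} ?f = \<xi> s - \<xi> 0" by (simp only: add_diff_cancel_left')
    ultimately have "(?f has_integral (\<xi> s - \<xi> 0)) {0..s}" by (simp only:)
    then show "((\<lambda>r. A *v \<xi> r + B *v v r) has_integral (\<xi> s - \<xi> 0)) {0..s}"
      by (rule has_integral_spike[OF neg, rotated]) (simp add: vu)
  qed
  then show thesis by (rule that[OF _ neg]) (simp add: vu)
qed

lemma trajectory_translate:
  assumes T: "trajectory A B U a b u \<xi>" and eq: "A *v x + B *v w = 0"
  shows "trajectory A B ((\<lambda>v. v + w) ` U) a b (\<lambda>s. u s + w) (\<lambda>s. \<xi> s + x)"
proof -
  have "trajectory A B {w} a b (\<lambda>_. w) (\<lambda>_. x)"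
    by (rule trajectory_of_derivative) (auto simp: eq)
  from trajectory_linear_combination[OF T this, of 1 1 "(\<lambda>v. v + w) ` U"]
  show ?thesis by simp
qed

section \<open>The dissipation form on states and controls\<close>

lemma stack_inner: "stack x u \<bullet> stack y v = x \<bullet> y + u \<bullet> v"
  unfolding inner_vec_def stack_def UNIV_Plus_UNIV[symmetric]
  by (simp add: sum.Plus del: UNIV_Plus_UNIV)

lemma block_matrix_mult_stack:
  "block_matrix M11 M12 M21 M22 *v stack x u = stack (M11 *v x + M12 *v u) (M21 *v x + M22 *v u)"
proof (rule vec_eq_iff[THEN iffD2], rule allI)
  fix i
  show "(block_matrix M11 M12 M21 M22 *v stack x u) $ i
      = stack (M11 *v x + M12 *v u) (M21 *v x + M22 *v u) $ i"
    unfolding matrix_vector_mult_def stack_def block_matrix_def UNIV_Plus_UNIV[symmetric]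
    by (cases i) (simp_all add: sum.Plus del: UNIV_Plus_UNIV)
qed

lemma linear_stack: "linear (\<lambda>p. stack (fst p) (snd p))"
proof (rule linearI)
  fix p q :: "(real^'n) \<times> (real^'m)" and c :: real
  show "stack (fst (p + q)) (snd (p + q)) = stack (fst p) (snd p) + stack (fst q) (snd q)"
    by (simp add: stack_def vec_eq_iff split: sum.split)
  show "stack (fst (c *\<^sub>R p)) (snd (c *\<^sub>R p)) = c *\<^sub>R stack (fst p) (snd p)"
    by (simp add: stack_def vec_eq_iff split: sum.split)
qed

lemma continuous_on_stack: "continuous_on S (\<lambda>p. stack (fst p) (snd p))"
  by (rule linear_continuous_on) (simp add: linear_stack flip: linear_conv_bounded_linear)

definition dissipation :: "real^('n + 'm)^('n + 'm) \<Rightarrow> real^'n \<Rightarrow> real^'m \<Rightarrow> real" where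
  "dissipation W x u = stack x u \<bullet> (W *v stack x u)"

lemma continuous_on_dissipation: "continuous_on S (\<lambda>p. dissipation W (fst p) (snd p))"
  for W :: "real^('n::finite + 'm::finite)^('n + 'm)"
  unfolding dissipation_def by (intro continuous_intros continuous_on_stack)

lemma dissipation_nonneg: "psd W \<Longrightarrow> 0 \<le> dissipation W x u"
  for W :: "real^('n::finite + 'm::finite)^('n + 'm)"
  by (simp add: dissipation_def psd_def)

lemma dissipation_le:
  fixes W :: "real^('n::finite + 'm::finite)^('n + 'm)"
  shows "dissipation W x u \<le> onorm ((*v) W) * ((norm x)\<^sup>2 + (norm u)\<^sup>2)"
proof -
  have "dissipation W x u \<le> norm (stack x u) * (onorm ((*v) W) * norm (stack x u))"
    unfolding dissipation_def
    by (rule order_trans[OF norm_cauchy_schwarz]) (intro mult_left_mono norm_matrix_vector_mult_le, simp)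
  also have "\<dots> = onorm ((*v) W) * (stack x u \<bullet> stack x u)"
    by (simp add: dot_square_norm power2_eq_square)
  finally show ?thesis unfolding stack_inner by (simp only: dot_square_norm)
qed

text \<open>In the storage rate J drops out by skewness and the \<open>R\<close> term cancels
  against the block QRQ. Replacing B + P by B - P costs 2 (Pu) \<bullet> (Qx), which the two
  off-diagonal blocks supply; only the symmetric part \<open>S\<close> of \<open>D\<close> is seen
  by u \<bullet> Du.\<close>

lemma supply_rate_eq_storage_plus_dissipation:
  fixes J R Q :: "real^'n^'n" and B P :: "real^'m^'n" and D S :: "real^'m^'m"
  assumes J: "J = - transpose J" and R: "psd R" and Q: "psd Q"
    and S: "S = (1/2) *\<^sub>R (D + transpose D)"
    and W: "W = block_matrix (Q ** R ** Q) (Q ** P) (transpose P ** Q) S"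
  shows "supply_rate (transpose (B + P) ** Q) D x u =
    (Q *v x) \<bullet> (((J - R) ** Q) *v x + (B - P) *v u) + dissipation W x u"
proof -
  let ?y = "Q *v x"
  have "?y \<bullet> (J *v ?y) = 0"
  proof -
    have "?y \<bullet> (J *v ?y) = (J *v ?y) \<bullet> ?y" by (rule inner_commute)
    also have "\<dots> = ?y \<bullet> (transpose J *v ?y)" by (rule inner_matrix_transpose)
    also have "transpose J = - J" using J by (metis minus_minus)
    finally show ?thesis by (simp add: matrix_vector_mult_uminus)
  qed
  moreover have "u \<bullet> (S *v u) = u \<bullet> (D *v u)"
  proof -
    have "u \<bullet> (transpose D *v u) = u \<bullet> (D *v u)"
      using inner_matrix_transpose[of D u u] by (simp add: inner_commute)
    then show ?thesis
      by (simp add: S matrix_vector_mult_add_rdistrib inner_add_right flip: scaleR_matrix_vector_assoc)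
  qed
  moreover have "dissipation W x u = ?y \<bullet> (R *v ?y) + 2 * ((P *v u) \<bullet> ?y) + u \<bullet> (S *v u)"
    using psd_symmetric[OF Q, of x "R *v ?y"] psd_symmetric[OF Q, of x "P *v u"]
      inner_matrix_transpose[of P u ?y]
    by (simp add: dissipation_def W block_matrix_mult_stack stack_inner inner_add_right inner_commute
        flip: matrix_vector_mul_assoc)
  moreover have "supply_rate (transpose (B + P) ** Q) D x u = ((B + P) *v u) \<bullet> ?y + u \<bullet> (D *v u)"
    by (simp add: supply_rate_def inner_add_right inner_matrix_transpose flip: matrix_vector_mul_assoc)
  ultimately show ?thesis
    by (simp add: matrix_vector_mult_diff_rdistrib matrix_vector_mult_add_rdistrib inner_add_right
        inner_diff_right inner_add_left inner_commute flip: matrix_vector_mul_assoc)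
qed

text \<open>Duration times a uniform bound of the integrand. The form c t (norm of the initial
  state), jointly continuous, is what lets the turnpike bound inherit continuity from the transfer
  time.\<close>

lemma dissipation_bound:
  fixes A :: "real^'n^'n" and B :: "real^'m^'n" and W :: "real^('n + 'm)^('n + 'm)"
  assumes "bounded U" and W: "psd W"
  shows "\<exists>c. continuous_on UNIV (\<lambda>p. c (fst p) (snd p)) \<and> (\<forall>t\<ge>0. \<forall>r. 0 \<le> c t r) \<and>
    (\<forall>t u \<xi> i. 0 \<le> t \<longrightarrow> trajectory A B U 0 t u \<xi> \<longrightarrow>
       ((\<lambda>s. dissipation W (\<xi> s) (u s)) has_integral i) {0..t} \<longrightarrow> i \<le> c t (norm (\<xi> 0)))"
proof -
  obtain a b where ab: "\<And>t u \<xi> s. trajectory A B U 0 t u \<xi> \<Longrightarrow> s \<in> {0..t} \<Longrightarrow>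
    norm (\<xi> s) \<le> 2 * exp (2 * a * t) * (norm (\<xi> 0) + b * t)"
    using trajectory_gronwall_bound[OF assms(1), of A B] by (elim exE conjE) metis
  obtain M where M: "\<And>u. u \<in> U \<Longrightarrow> norm u \<le> M" using assms(1) unfolding bounded_iff by metis
  define k where "k = onorm ((*v) W)"
  have k: "0 \<le> k" by (simp add: k_def onorm_pos_le)
  define c where "c t r = t * (k * ((2 * exp (2 * a * t) * (r + b * t))\<^sup>2 + M\<^sup>2))" for t r
  show ?thesis
  proof (intro exI[of _ c] conjI allI impI)
    show "continuous_on UNIV (\<lambda>p. c (fst p) (snd p))"
      unfolding c_def by (intro continuous_intros)
    show "0 \<le> c t r" if "0 \<le> t" for t r
      unfolding c_def using that k by (intro mult_nonneg_nonneg add_nonneg_nonneg) auto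
    fix t u \<xi> i
    assume t: "0 \<le> t" and T: "trajectory A B U 0 t u \<xi>"
      and i: "((\<lambda>s. dissipation W (\<xi> s) (u s)) has_integral i) {0..t}"
    let ?g = "2 * exp (2 * a * t) * (norm (\<xi> 0) + b * t)"
    have "((\<lambda>s. k * (?g\<^sup>2 + M\<^sup>2)) has_integral (measure lborel {0..t} *\<^sub>R (k * (?g\<^sup>2 + M\<^sup>2)))) {0..t}"
      by (rule has_integral_const_real)
    moreover have "dissipation W (\<xi> s) (u s) \<le> k * (?g\<^sup>2 + M\<^sup>2)" if s: "s \<in> {0..t}" for s
    proof -
      have "dissipation W (\<xi> s) (u s) \<le> k * ((norm (\<xi> s))\<^sup>2 + (norm (u s))\<^sup>2)"
        unfolding k_def by (rule dissipation_le)
      also have "\<dots> \<le> k * (?g\<^sup>2 + M\<^sup>2)"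
        using k by (intro mult_left_mono add_mono power_mono ab[OF T s] M trajectoryD(1)[OF T s]) auto
      finally show ?thesis .
    qed
    ultimately have "i \<le> measure lborel {0..t} *\<^sub>R (k * (?g\<^sup>2 + M\<^sup>2))"
      using has_integral_le[OF i] by blast
    then show "i \<le> c t (norm (\<xi> 0))" using t by (simp add: c_def)
  qed
qed

section \<open>Reachability as steerability of the shifted system\<close>

lemma reach_at_iff_trajectory:
  assumes U: "bounded U" "w \<in> U" and t: "0 \<le> t"
  shows "x \<in> reach_at A B U t z \<longleftrightarrow> (\<exists>u \<xi>. trajectory A B U 0 t u \<xi> \<and> \<xi> 0 = x \<and> \<xi> t = z)"
proof
  assume x: "x \<in> reach_at A B U t z"
  show "\<exists>u \<xi>. trajectory A B U 0 t u \<xi> \<and> \<xi> 0 = x \<and> \<xi> t = z"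
  proof (cases "t = 0")
    \<comment> \<open>\<open>reach_at\<close> treats duration 0 separately; the matching trajectory
      lives on one point and may use any control value in \<open>U\<close>.\<close>
    case True
    have "trajectory A B U 0 0 (\<lambda>_. w) (\<lambda>_. x)"
      using U(2) integrable_const_ivl[of w "0::real" 0] by (auto simp: trajectory_def)
    then show ?thesis using True x by (auto simp: reach_at_def)
  next
    case False
    then obtain u \<xi> where "u \<in> L1_controls t U" "is_solution A B t u \<xi>" "\<xi> 0 = x" "\<xi> t = z"
      using x by (auto simp: reach_at_def)
    then show ?thesis using solution_obtain_trajectory[OF _ _ U(2)] by metis
  qed
next
  assume "\<exists>u \<xi>. trajectory A B U 0 t u \<xi> \<and> \<xi> 0 = x \<and> \<xi> t = z"
  then obtain u \<xi> where T: "trajectory A B U 0 t u \<xi>" "\<xi> 0 = x" "\<xi> t = z" by blast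
  show "x \<in> reach_at A B U t z"
  proof (cases "t = 0")
    case False
    then show ?thesis
      using trajectory_is_solution[OF T(1) U(1)] T(2,3) unfolding reach_at_def by auto
  qed (use T in \<open>simp add: reach_at_def\<close>)
qed

text \<open>Subtracting the equilibrium (z, w), itself a constant trajectory, moves the target to 0
  and the controls to U - w.\<close>

lemma reach_at_steady_state_iff:
  assumes U: "bounded U" "w \<in> U" and t: "0 \<le> t" and eq: "A *v z + B *v w = 0"
  shows "x \<in> reach_at A B U t z \<longleftrightarrow> x - z \<in> steerable A B ((\<lambda>v. v - w) ` U) t"
  unfolding reach_at_iff_trajectory[OF U t] steerable_def
proof (intro iffI CollectI; elim CollectE exE conjE)
  fix u \<xi> assume T: "trajectory A B U 0 t u \<xi>" "\<xi> 0 = x" "\<xi> t = z"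
  have "A *v (- z) + B *v (- w) = - (A *v z + B *v w)"
    by (simp add: linear_neg[OF matrix_vector_mul_linear])
  then have "trajectory A B ((\<lambda>v. v - w) ` U) 0 t (\<lambda>s. u s - w) (\<lambda>s. \<xi> s - z)"
    using trajectory_translate[OF T(1), of "- z" "- w"] eq by simp
  then show "\<exists>u \<xi>. trajectory A B ((\<lambda>v. v - w) ` U) 0 t u \<xi> \<and> \<xi> 0 = x - z \<and> \<xi> t = 0"
    using T by (intro exI[of _ "\<lambda>s. u s - w"] exI[of _ "\<lambda>s. \<xi> s - z"]) simp
next
  fix u \<xi> assume T: "trajectory A B ((\<lambda>v. v - w) ` U) 0 t u \<xi>" "\<xi> 0 = x - z" "\<xi> t = 0"
  have "trajectory A B U 0 t (\<lambda>s. u s + w) (\<lambda>s. \<xi> s + z)"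
    using trajectory_translate[OF T(1) eq] by (simp add: image_image)
  then show "\<exists>u \<xi>. trajectory A B U 0 t u \<xi> \<and> \<xi> 0 = x \<and> \<xi> t = z"
    using T by (intro exI[of _ "\<lambda>s. u s + w"] exI[of _ "\<lambda>s. \<xi> s + z"]) simp
qed

text \<open>
  Competitor for the optimal pair: steer \<open>x\<^sup>0\<close> to the steady state, stay there at no dissipation,
  and leave for \<open>\<Phi>\<close> along a fixed trajectory. By the energy balance the dissipation of the optimal
  pair exceeds that of the competitor by at most the final storage of the competitor.
\<close>
lemma integral_turnpike_of_dissipativity:
  fixes A Q :: "real^'n^'n" and B :: "real^'m^'n" and C :: "real^'n^'m" and D :: "real^'m^'m"
    and W :: "real^('n + 'm)^('n + 'm)"
  assumes Q: "psd Q" and W: "psd W"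
    and balance: "\<And>x u. supply_rate C D x u = (Q *v x) \<bullet> (A *v x + B *v u) + dissipation W x u"
    and U: "convex U" "bounded U" "w \<in> interior U"
    and steady: "A *v z + B *v w = 0" "dissipation W z w = 0"
    and reach: "z \<in> reach_set A B U \<Phi>"
  shows "integral_turnpike A B C D U \<Phi> (reach_point A B U z) (ker W)"
proof -
  have wU: "w \<in> U" using U(3) interior_subset by blast
  let ?V = "(\<lambda>v. v - w) ` U"
  define Z where "Z = (\<Union>t\<in>{0..}. steerable A B ?V t)"
  have Vc: "convex ?V" using U(1) by (simp add: convex_translation_subtract_eq)
  have Vb: "bounded ?V" using bounded_translation_minus[OF U(2), of w] by simp
  have V0: "0 \<in> interior ?V"
    using U(3) interior_translation_subtract[of w U] by (auto simp: image_iff)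
  have XZ: "x - z \<in> Z" if "x \<in> reach_point A B U z" for x
    using that reach_at_steady_state_iff[OF U(2) wU _ steady(1), where x = x]
    unfolding reach_point_def Z_def by blast
  obtain \<tau> where \<tau>: "continuous_on Z \<tau>" "\<And>x. x \<in> Z \<Longrightarrow> 0 \<le> \<tau> x \<and> x \<in> steerable A B ?V (\<tau> x)"
    using steerable_continuous_time[OF Vc Vb V0, of A B] unfolding Z_def[symmetric] by blast
  obtain c where c: "continuous_on UNIV (\<lambda>p. c (fst p) (snd p))" "\<And>t r. t \<ge> 0 \<Longrightarrow> 0 \<le> c t r"
    and cb: "\<And>t u \<xi> i. 0 \<le> t \<Longrightarrow> trajectory A B U 0 t u \<xi> \<Longrightarrow>
       ((\<lambda>s. dissipation W (\<xi> s) (u s)) has_integral i) {0..t} \<Longrightarrow> i \<le> c t (norm (\<xi> 0))"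
    using dissipation_bound[OF U(2) W, of A B] by (elim exE conjE) metis
  obtain \<kappa> where \<kappa>: "\<kappa> > 0" "\<And>v. (infdist v (ker W))\<^sup>2 \<le> \<kappa> * (v \<bullet> (W *v v))"
    using infdist_ker_le[OF W] by blast
  have integrable: "(\<lambda>s. dissipation W (\<xi> s) (u s)) integrable_on {a..b}"
    if "trajectory A B U a b u \<xi>" for a b u \<xi>
    using trajectory_absolutely_integrable[OF that U(2) continuous_on_dissipation]
    by (rule set_lebesgue_integral_eq_integral(1))
  have cost: "cost C D T \<xi> u = \<xi> T \<bullet> (Q *v \<xi> T) / 2 - \<xi> 0 \<bullet> (Q *v \<xi> 0) / 2 + i"
    if T: "0 \<le> T" and tr: "trajectory A B U 0 T u \<xi>"
      and i: "((\<lambda>s. dissipation W (\<xi> s) (u s)) has_integral i) {0..T}" for T u \<xi> i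
    unfolding cost_def balance
    by (rule integral_unique[OF has_integral_add[OF trajectory_energy[OF tr U(2) Q T] i]])
  obtain y t3 where y: "y \<in> \<Phi>" and t3: "0 \<le> t3" "z \<in> reach_at A B U t3 y"
    using reach by (auto simp: reach_set_def reach_point_def)
  obtain u3 \<xi>3 where tr3: "trajectory A B U 0 t3 u3 \<xi>3" "\<xi>3 0 = z" "\<xi>3 t3 = y"
    using t3(2) unfolding reach_at_iff_trajectory[OF U(2) wU t3(1)] by blast
  define i3 where "i3 = integral {0..t3} (\<lambda>s. dissipation W (\<xi>3 s) (u3 s))"
  have i3: "((\<lambda>s. dissipation W (\<xi>3 s) (u3 s)) has_integral i3) {0..t3}"
    unfolding i3_def by (rule integrable_integral[OF integrable[OF tr3(1)]])
  have i30: "0 \<le> i3"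
    using i3 by (rule has_integral_nonneg) (rule dissipation_nonneg[OF W])
  define h where "h = y \<bullet> (Q *v y) / 2"
  have h0: "0 \<le> h" using Q by (simp add: h_def psd_def)
  \<comment> \<open>Final storage of the competitor plus its dissipation on the way in and on the
    way out, converted to squared distance by \<kappa>. Only the middle term depends on x.\<close>
  define F where "F x = \<kappa> * (h + c (\<tau> (x - z)) (norm x) + i3)" for x
  let ?X = "reach_point A B U z"
  have \<tau>cont: "continuous_on ?X (\<lambda>x. \<tau> (x - z))"
    by (rule continuous_on_compose2[OF \<tau>(1)]) (auto intro!: continuous_intros XZ)
  have Fcont: "continuous_on ?X F"
  proof -
    have "continuous_on ?X (\<lambda>x. (\<tau> (x - z), norm x))"
      by (intro continuous_on_Pair \<tau>cont continuous_intros)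
    from continuous_on_compose2[OF c(1) this]
    have "continuous_on ?X (\<lambda>x. c (\<tau> (x - z)) (norm x))" by simp
    then show ?thesis unfolding F_def by (intro continuous_intros)
  qed
  have main: "(\<lambda>t. (infdist (stack (x t) (u t)) (ker W))\<^sup>2) integrable_on {0..T} \<and>
      integral {0..T} (\<lambda>t. (infdist (stack (x t) (u t)) (ker W))\<^sup>2) \<le> F x0"
    if x0: "x0 \<in> ?X" and T: "T > \<tau> (x0 - z) + t3" and opt: "optimal_pair A B C D U \<Phi> T x0 x u"
    for x0 T x u
  proof -
    let ?s = "\<tau> (x0 - z)"
    have s0: "0 \<le> ?s" and "x0 - z \<in> steerable A B ?V ?s" using \<tau>(2)[OF XZ[OF x0]] by auto
    then have "x0 \<in> reach_at A B U ?s z"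
      using reach_at_steady_state_iff[OF U(2) wU s0 steady(1)] by blast
    then obtain u1 \<xi>1 where tr1: "trajectory A B U 0 ?s u1 \<xi>1" "\<xi>1 0 = x0" "\<xi>1 ?s = z"
      unfolding reach_at_iff_trajectory[OF U(2) wU s0] by blast
    have T0: "0 \<le> T" using T s0 t3 by linarith
    define i1 where "i1 = integral {0..?s} (\<lambda>s. dissipation W (\<xi>1 s) (u1 s))"
    have i1: "((\<lambda>s. dissipation W (\<xi>1 s) (u1 s)) has_integral i1) {0..?s}"
      unfolding i1_def by (rule integrable_integral[OF integrable[OF tr1(1)]])
    have i1le: "i1 \<le> c ?s (norm x0)" using cb[OF s0 tr1(1) i1] tr1(2) by simp
    have tr2: "trajectory A B U ?s (T - t3) (\<lambda>_. w) (\<lambda>_. z)"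
      by (rule trajectory_of_derivative) (auto simp: steady wU)
    have i2: "((\<lambda>s. dissipation W z w) has_integral 0) {?s..T - t3}"
      by (simp add: steady(2))
    obtain u2 \<xi>2 where tr2': "trajectory A B U 0 (T - t3) u2 \<xi>2" "\<xi>2 0 = x0" "\<xi>2 (T - t3) = z"
      and i2': "((\<lambda>s. dissipation W (\<xi>2 s) (u2 s)) has_integral i1) {0..T - t3}"
      using trajectory_concat_cost[OF tr1(1) tr2 s0 _ _ i1 i2] T tr1 by auto
    have tr3': "trajectory A B U (T - t3) T (\<lambda>s. u3 (s - (T - t3))) (\<lambda>s. \<xi>3 (s - (T - t3)))"
      using trajectory_shift[OF tr3(1), of "T - t3"] by simp
    have i3': "((\<lambda>s. dissipation W (\<xi>3 (s - (T - t3))) (u3 (s - (T - t3)))) has_integral i3) {T - t3..T}"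
      using has_integral_shift_real_ivl[OF i3, of "- (T - t3)"] by (simp add: algebra_simps)
    have "0 \<le> T - t3" "T - t3 \<le> T" "\<xi>2 (T - t3) = \<xi>3 (T - t3 - (T - t3))"
      using T s0 t3 tr2' tr3 by auto
    from trajectory_concat_cost[OF tr2'(1) tr3' this i2' i3']
    obtain v \<zeta> where tr: "trajectory A B U 0 T v \<zeta>" "\<zeta> 0 = x0" "\<zeta> T = y"
      and i: "((\<lambda>s. dissipation W (\<zeta> s) (v s)) has_integral (i1 + i3)) {0..T}"
      using tr2'(2) tr3(3) by auto
    have "admissible_pair A B U \<Phi> T x0 \<zeta> v"
      using trajectory_is_solution[OF tr(1) U(2)] tr(2,3) y by (simp add: admissible_pair_def)
    then have le: "cost C D T x u \<le> cost C D T \<zeta> v"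
      using opt unfolding optimal_pair_def by blast
    have adm: "u \<in> L1_controls T U" "is_solution A B T u x" "x 0 = x0"
      using opt by (auto simp: optimal_pair_def admissible_pair_def)
    obtain v' N where tr': "trajectory A B U 0 T v' x" and N: "negligible N"
      and v': "\<And>s. s \<in> {0..T} - N \<Longrightarrow> v' s = u s"
      by (rule solution_obtain_trajectory[OF adm(1,2) wU]) blast
    define k where "k = integral {0..T} (\<lambda>s. dissipation W (x s) (v' s))"
    have k: "((\<lambda>s. dissipation W (x s) (v' s)) has_integral k) {0..T}"
      unfolding k_def by (rule integrable_integral[OF integrable[OF tr']])
    have "cost C D T x u = cost C D T x v'"
      unfolding cost_def by (rule integral_spike[OF N]) (simp add: v')
    \<comment> \<open>Both pairs start at x0, so the initial storage cancels; the final storage of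
      the optimal state is nonnegative and is then dropped.\<close>
    with le have "x T \<bullet> (Q *v x T) / 2 - x0 \<bullet> (Q *v x0) / 2 + k \<le> h - x0 \<bullet> (Q *v x0) / 2 + (i1 + i3)"
      unfolding cost[OF T0 tr' k] cost[OF T0 tr(1) i] by (simp add: tr adm h_def)
    moreover have "0 \<le> x T \<bullet> (Q *v x T)" using Q by (simp add: psd_def)
    ultimately have kle: "k \<le> h + c ?s (norm x0) + i3" using i1le by linarith
    let ?d = "\<lambda>v t. (infdist (stack (x t) (v t)) (ker W))\<^sup>2"
    have "continuous_on UNIV (\<lambda>p :: (real^'n) \<times> (real^'m). (infdist (stack (fst p) (snd p)) (ker W))\<^sup>2)"
      by (intro continuous_intros continuous_on_stack)
    from trajectory_absolutely_integrable[OF tr' U(2) this]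
    have dint: "?d v' integrable_on {0..T}"
      by (rule set_lebesgue_integral_eq_integral(1))
    have "integral {0..T} (?d v') \<le> \<kappa> * k"
    proof (rule has_integral_le[OF integrable_integral[OF dint]])
      show "((\<lambda>t. \<kappa> * dissipation W (x t) (v' t)) has_integral \<kappa> * k) {0..T}"
        using has_integral_mult_right[OF k] .
      show "?d v' t \<le> \<kappa> * dissipation W (x t) (v' t)" for t
        unfolding dissipation_def by (rule \<kappa>(2))
    qed
    also have "\<dots> \<le> F x0" unfolding F_def using kle \<kappa>(1) by (intro mult_left_mono) auto
    finally have "integral {0..T} (?d v') \<le> F x0" .
    moreover have "integral {0..T} (?d u) = integral {0..T} (?d v')"
      by (rule integral_spike[OF N]) (simp add: v')
    moreover have "?d u integrable_on {0..T}"
      by (rule integrable_spike[OF dint N]) (simp add: v')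
    ultimately show ?thesis by simp
  qed
  show ?thesis
    unfolding integral_turnpike_def
  proof (rule exI[of _ F], rule exI[of _ "\<lambda>x. \<tau> (x - z) + t3"], intro conjI ballI allI impI)
    show "continuous_on ?X F" by (rule Fcont)
    show "continuous_on ?X (\<lambda>x. \<tau> (x - z) + t3)" by (intro continuous_intros \<tau>cont)
    fix x0 assume x0: "x0 \<in> ?X"
    then have "0 \<le> \<tau> (x0 - z)" using \<tau>(2)[OF XZ] by blast
    then show "0 \<le> F x0" "0 \<le> \<tau> (x0 - z) + t3"
      using c(2) h0 i30 t3 \<kappa>(1) by (simp_all add: F_def)
  next
    fix x0 T x u
    assume "x0 \<in> ?X" "\<tau> (x0 - z) + t3 < T" "optimal_pair A B C D U \<Phi> T x0 x u"
    note * = main[OF this]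
    from * show "(\<lambda>t. (infdist (stack (x t) (u t)) (ker W))\<^sup>2) integrable_on {0..T}" ..
    from * show "integral {0..T} (\<lambda>t. (infdist (stack (x t) (u t)) (ker W))\<^sup>2) \<le> F x0" ..
  qed
qed

theorem theorem3p16:
  fixes J R Q :: "real^'n^'n"
    and B P :: "real^'m^'n"
    and D :: "real^'m^'m"
    and S :: "real^'m^'m"
    and W :: "real^('n + 'm)^('n + 'm)"
    and U :: "(real^'m) set"
    and \<Phi> :: "(real^'n) set"
    and xb :: "real^'n" and ub :: "real^'m"
  assumes "J = - transpose J"
    and "psd R"
    and "psd Q"
    and "S = (1/2) *\<^sub>R (D + transpose D)"
    and "psd S"
    and "W = block_matrix (Q ** R ** Q) (Q ** P) (transpose P ** Q) S"
    and "psd W"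
    and "W \<noteq> 0"
    and "convex U" and "compact U" and "0 \<in> interior U"
    and "closed \<Phi>"
    and "optimal_steady_state ((J - R) ** Q) (B - P) (transpose (B + P) ** Q) D U xb ub"
    and "ub \<in> interior U"
    and "xb \<in> reach_set ((J - R) ** Q) (B - P) U \<Phi>"
  shows "integral_turnpike ((J - R) ** Q) (B - P) (transpose (B + P) ** Q) D U \<Phi>
           (reach_point ((J - R) ** Q) (B - P) U xb) (ker W) \<and>
         (controllable ((J - R) ** Q) (B - P) \<longrightarrow>
           reach_point ((J - R) ** Q) (B - P) U xb = UNIV)"
proof (intro conjI impI)
  let ?A = "(J - R) ** Q" and ?B = "B - P" and ?C = "transpose (B + P) ** Q"
  note balance = supply_rate_eq_storage_plus_dissipation[OF assms(1-4,6), of B]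
  have U: "bounded U" using assms(10) by (rule compact_imp_bounded)
  have ubU: "ub \<in> U" using assms(14) interior_subset by blast
  have steady: "?A *v xb + ?B *v ub = 0"
    using assms(13) by (simp add: optimal_steady_state_def steady_state_def)
  have "steady_state ?A ?B U 0 0"
    using assms(11) interior_subset by (auto simp: steady_state_def)
  then have "supply_rate ?C D xb ub \<le> supply_rate ?C D 0 0"
    using assms(13) by (simp add: optimal_steady_state_def)
  also have "\<dots> = 0" by (simp add: supply_rate_def)
  \<comment> \<open>At a steady state the storage term in the balance vanishes, so the supply rate
    is the dissipation alone.\<close>
  finally have "dissipation W xb ub \<le> 0"
    unfolding balance steady by simp
  then have "dissipation W xb ub = 0"
    using dissipation_nonneg[OF assms(7), of xb ub] by simp
  then show "integral_turnpike ?A ?B ?C D U \<Phi> (reach_point ?A ?B U xb) (ker W)"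
    using integral_turnpike_of_dissipativity[OF assms(3,7) balance assms(9) U assms(14) steady _ assms(15)]
    by blast
  assume ctrl: "controllable ?A ?B"
  let ?V = "(\<lambda>v. v - ub) ` U"
  have "convex ?V" using assms(9) by (simp add: convex_translation_subtract_eq)
  moreover have "bounded ?V" using bounded_translation_minus[OF U, of ub] by simp
  moreover have "0 \<in> interior ?V"
    using assms(14) interior_translation_subtract[of ub U] by (auto simp: image_iff)
  ultimately have "(\<Union>t\<in>{0..}. steerable ?A ?B ?V t) = UNIV"
    by (rule all_states_steerable[OF assms(1-3) _ _ _ ctrl])
  then have "\<exists>t\<ge>0. x - xb \<in> steerable ?A ?B ?V t" for x by auto
  then have "\<exists>t\<ge>0. x \<in> reach_at ?A ?B U t xb" for x
    using reach_at_steady_state_iff[OF U ubU _ steady] by blast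
  then show "reach_point ?A ?B U xb = UNIV"
    unfolding reach_point_def by auto
qed

end
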